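(* Let $\Gamma$ be a $\vartheta$-admissible configuration on $\mathbb{R}^d$ and $\alpha\in(0,2)$. Let $k:\mathbb{R}^d\times\mathbb{R}^d\to[0,\infty]$ be a measurable function satisfying $k(x,y)=k(y,x)$ and $$\Lambda^{-1}\big(\mathbf 1_{V^\Gamma[x]}(y)+\mathbf 1_{V^\Gamma[y]}(x)\big)|x-y|^{-d-\alpha}\le k(x,y)\le \Lambda|x-y|^{-d-\alpha}$$ for all $x$ and $y$, where $\Lambda\ge 1$ is some constant. Then there is a constant $c\ge 1$ such that for every ball $B\subset\mathbb{R}^d$ and every $f\in L^2(B)$, $$\int_{B\times B}(f(x)-f(y))^2|x-y|^{-d-\alpha}\,d(x,y)\le c\int_{B\times B}(f(x)-f(y))^2k(x,y)\,d(x,y).$$ The constant $c$ depends on $\Lambda$, the dimension $d$ and $\vartheta$; it is independent of $k$ and $\Gamma$. For $0<\alpha_0\le\alpha<2$, the constant $c$ depends on $\alpha_0$ but not on $\alpha$ (i.e. given $d,\vartheta,\Lambda,\alpha_0$, one $c$ works for all $\alpha\in[\alpha_0,2)$).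
   Context: For $v\in\mathbb{S}^{d-1}$ and $\vartheta\in(0,\frac{\pi}{2}]$ the cone with symmetry axis $v$ and apex angle $\vartheta$ is $\widetilde V(v,\vartheta)=\{h\in\mathbb{R}^d : h\neq 0,\ \langle v,h\rangle/|h|>\cos\vartheta\}$ and the double cone is $V(v,\vartheta)=\widetilde V(v,\vartheta)\cup(-\widetilde V(v,\vartheta))$. Let $\mathcal V$ be the set of all double cones. A configuration is a map $\Gamma:\mathbb{R}^d\to\mathcal V$. It is called $\vartheta$-bounded if the infimum $\vartheta$ of the apex angles of the double cones in $\Gamma(\mathbb{R}^d)$ is positive. It is called $\vartheta$-admissible if in addition $\{(x,y)\in\mathbb{R}^d\times\mathbb{R}^d : y-x\in\Gamma(x)\}$ is a Borel set in $\mathbb{R}^d\times\mathbb{R}^d$. Put $V^\Gamma[x]=x+\Gamma(x)$. $|\cdot|$ is the Euclidean norm. Conventions on the diagonal (a null set): $0^{-d-\alpha}=+\infty$ and $0\cdot\infty=0$. Integrals may take the value $+\infty$. *)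

theory Defs
  imports "HOL-Analysis.Analysis"
begin

definition single_cone :: "real^'n \<Rightarrow> real \<Rightarrow> (real^'n) set" where
  "single_cone v \<theta> = {h. h \<noteq> 0 \<and> (v \<bullet> h) / norm h > cos \<theta>}"

definition double_cone :: "real^'n \<Rightarrow> real \<Rightarrow> (real^'n) set" where
  "double_cone v \<theta> = single_cone v \<theta> \<union> uminus ` single_cone v \<theta>"

definition is_apex_angle :: "(real^'n) set \<Rightarrow> real \<Rightarrow> bool" where
  "is_apex_angle V \<theta> \<longleftrightarrow> 0 < \<theta> \<and> \<theta> \<le> pi / 2 \<and> (\<exists>v. norm v = 1 \<and> V = double_cone v \<theta>)"

definition double_cones :: "(real^'n) set set" where
  "double_cones = {V. \<exists>\<theta>. is_apex_angle V \<theta>}"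

definition configuration :: "(real^'n \<Rightarrow> (real^'n) set) \<Rightarrow> bool" where
  "configuration \<Gamma> \<longleftrightarrow> range \<Gamma> \<subseteq> double_cones"

text \<open>In dimension at least two a double cone, as a set, determines its apex angle, so the function
  \<open>ang\<close> below is unique on the range of the configuration. In dimension one every double cone is the
  punctured line, for every angle; the existential then admits any choice of angle.\<close>

definition theta_bounded :: "real \<Rightarrow> (real^'n \<Rightarrow> (real^'n) set) \<Rightarrow> bool" where
  "theta_bounded \<theta> \<Gamma> \<longleftrightarrow> configuration \<Gamma> \<and>
     (\<exists>ang. (\<forall>V\<in>range \<Gamma>. is_apex_angle V (ang V)) \<and> \<theta> = (INF V\<in>range \<Gamma>. ang V)) \<and> 0 < \<theta>"

definition theta_admissible :: "real \<Rightarrow> (real^'n \<Rightarrow> (real^'n) set) \<Rightarrow> bool" where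
  "theta_admissible \<theta> \<Gamma> \<longleftrightarrow> theta_bounded \<theta> \<Gamma> \<and> {(x, y). y - x \<in> \<Gamma> x} \<in> sets borel"

definition shifted_cone :: "(real^'n \<Rightarrow> (real^'n) set) \<Rightarrow> real^'n \<Rightarrow> (real^'n) set" where
  "shifted_cone \<Gamma> x = (\<lambda>h. x + h) ` \<Gamma> x"

text \<open>The kernel \<open>|x - y|\<close> to the power \<open>-d - \<alpha>\<close>. The diagonal is treated separately because
  \<open>0 powr a = 0\<close> in the library, whereas the value there has to be infinite.\<close>

definition frac_kernel :: "real \<Rightarrow> real^'n \<Rightarrow> real^'n \<Rightarrow> ennreal" where
  "frac_kernel \<alpha> x y =
     (if x = y then \<infinity> else ennreal (norm (x - y) powr (- real CARD('n) - \<alpha>)))"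

definition L2_on :: "(real^'n) set \<Rightarrow> (real^'n \<Rightarrow> real) \<Rightarrow> bool" where
  "L2_on B f \<longleftrightarrow> f \<in> borel_measurable (lebesgue_on B) \<and> integrable (lebesgue_on B) (\<lambda>x. (f x)\<^sup>2)"

end

theory Submission
  imports Defs
begin

text \<open>
  At a single scale \<open>s\<close>, consider a region that is a union of balls of radius \<open>s\<close> centred in a convex set,
  and cover it by a finite net of tiny balls. The cone at a point of the region contains a comparatively
  large ball of the region, so for one such ball \<open>S\<close> the function is controlled, in mean square, on all
  net balls inside \<open>S\<close>. Now move \<open>S\<close> through the region in tiny steps: a net ball just outside \<open>S\<close> consists
  of points whose double cones, whatever their directions, contain a net ball inside \<open>S\<close>. By pigeonhole a
  fixed fraction of it uses the same net ball, which passes the control on. This yields a Poincare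
  inequality on the region that only uses pairs seen through the cones. Averaging it over all positions of
  the region inside the given ball, and summing over dyadic scales with weights \<open>s powr (- d - \<alpha>)\<close>,
  gives the theorem. All scales enter with the same constant, so it does not deteriorate as \<open>\<alpha>\<close> tends to 2.
\<close>

subsection \<open>Geometry of double cones\<close>

text \<open>From a point on or slightly outside a sphere, one of the two directions \<open>v\<close> and \<open>- v\<close> does not point
  outwards; bending it a little towards the centre leads into the ball without leaving the double cone.\<close>

lemma ball_in_double_cone:
  fixes v x w :: "'a::euclidean_space"
  assumes \<kappa>: "0 < \<kappa>" "\<kappa> \<le> 1" and c: "c = \<kappa>\<^sup>2 / 320"
    and v: "norm v = 1" and \<tau>: "0 < \<tau>" and x: "norm (x - w) \<le> (1 + 2 * c) * \<tau>"
  obtains y t where "norm (y - w) + 3 * c * \<tau> \<le> \<tau>"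
    and "\<And>y'. norm (y' - y) < 3 * c * \<tau> \<Longrightarrow> norm (y' - x - t *\<^sub>R v) < \<kappa> * \<bar>t\<bar>"
proof -
  define \<beta> where "\<beta> = \<kappa> / 4"
  define u where "u = (if (x - w) \<bullet> v \<le> 0 then v else - v)"
  define e :: real where "e = (if (x - w) \<bullet> v \<le> 0 then 1 else -1)"
  have eu: "u = e *\<^sub>R v" "\<bar>e\<bar> = 1" by (auto simp: u_def e_def)
  have u: "norm u = 1" "(x - w) \<bullet> u \<le> 0" using v by (auto simp: u_def)
  have \<beta>: "0 < \<beta>" "\<beta> \<le> 1/4" using \<kappa> by (auto simp: \<beta>_def)
  have c\<beta>: "c = \<beta>\<^sup>2 / 20" by (simp add: c \<beta>_def power2_eq_square)
  have c2: "1 + 2 * c = 1 + \<beta>\<^sup>2/10" by (simp add: c\<beta>)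
  have \<beta>2: "0 < \<beta>\<^sup>2" "\<beta>\<^sup>2 \<le> 1/16" using \<beta> power_mono[of \<beta> "1/4" 2] by (auto simp: power2_eq_square)
  define d where "d = x - w"
  \<comment> \<open>For \<open>x\<close> near the sphere the bending lowers the squared distance to
    \<open>w\<close> by about \<open>2 * \<beta>\<^sup>2 * \<tau>\<^sup>2\<close>. The axial step
    adds at most \<open>(\<beta> * \<tau>)\<^sup>2\<close>, because \<open>d \<bullet> u\<close> is
    not positive. The surplus pays for the radius \<open>3 * c * \<tau>\<close> and for starting
    slightly outside.\<close>
  define y where "y = x + \<beta> *\<^sub>R (\<tau> *\<^sub>R u - \<beta> *\<^sub>R d)"
  have yw: "y - w = (1 - \<beta>\<^sup>2) *\<^sub>R d + (\<beta> * \<tau>) *\<^sub>R u"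
    by (simp add: y_def d_def algebra_simps power2_eq_square)
  have "(norm (y - w))\<^sup>2 = (1 - \<beta>\<^sup>2)\<^sup>2 * (norm d)\<^sup>2 + 2 * ((1 - \<beta>\<^sup>2) * (\<beta> * \<tau>)) * (d \<bullet> u) + (\<beta> * \<tau>)\<^sup>2"
    unfolding yw power2_norm_eq_inner using u(1)
    by (simp add: algebra_simps inner_commute norm_eq_1 power2_eq_square)
  also have "\<dots> \<le> (1 - \<beta>\<^sup>2)\<^sup>2 * ((1 + 2 * c) * \<tau>)\<^sup>2 + (\<beta> * \<tau>)\<^sup>2"
  proof -
    have "(norm d)\<^sup>2 \<le> ((1 + 2 * c) * \<tau>)\<^sup>2" using x by (intro power_mono) (auto simp: d_def)
    hence "(1 - \<beta>\<^sup>2)\<^sup>2 * (norm d)\<^sup>2 \<le> (1 - \<beta>\<^sup>2)\<^sup>2 * ((1 + 2 * c) * \<tau>)\<^sup>2" by (intro mult_left_mono) auto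
    moreover have "2 * ((1 - \<beta>\<^sup>2) * (\<beta> * \<tau>)) * (d \<bullet> u) \<le> 0"
      using u(2) \<beta> \<beta>2 \<tau> by (intro mult_nonneg_nonpos) (auto simp: d_def)
    ultimately show ?thesis by linarith
  qed
  also have "\<dots> = ((1 - \<beta>\<^sup>2)\<^sup>2 * (1 + \<beta>\<^sup>2/10)\<^sup>2 + \<beta>\<^sup>2) * \<tau>\<^sup>2"
    unfolding c2 power_mult_distrib by (simp add: algebra_simps)
  also have "\<dots> \<le> (1 - 3 * \<beta>\<^sup>2/20)\<^sup>2 * \<tau>\<^sup>2"
  proof (intro mult_right_mono)
    define b where "b = \<beta>\<^sup>2"
    have b: "0 < b" "b \<le> 1/16" using \<beta>2 by (auto simp: b_def)
    have "(1 - b) * (1 + b/10) \<le> 1 - 9*b/10" using b by (simp add: field_simps)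
    moreover have "0 \<le> (1 - b) * (1 + b/10)" using b by (intro mult_nonneg_nonneg) auto
    ultimately have "((1 - b) * (1 + b/10))\<^sup>2 \<le> (1 - 9*b/10)\<^sup>2" by (rule power_mono)
    moreover have "(1 - 9*b/10)\<^sup>2 + b \<le> (1 - 3*b/20)\<^sup>2"
    proof -
      have "(1 - 3*b/20)\<^sup>2 - (1 - 9*b/10)\<^sup>2 - b = b * (1/2 - (63/80) * b)"
        by (simp add: power2_eq_square field_simps)
      moreover have "0 \<le> b * (1/2 - (63/80) * b)" using b by (intro mult_nonneg_nonneg) auto
      ultimately show ?thesis by linarith
    qed
    ultimately show "(1 - \<beta>\<^sup>2)\<^sup>2 * (1 + \<beta>\<^sup>2/10)\<^sup>2 + \<beta>\<^sup>2 \<le> (1 - 3 * \<beta>\<^sup>2/20)\<^sup>2"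
      by (simp add: b_def power_mult_distrib)
  qed auto
  finally have "(norm (y - w))\<^sup>2 \<le> ((1 - 3 * \<beta>\<^sup>2/20) * \<tau>)\<^sup>2" by (simp add: power_mult_distrib)
  hence "norm (y - w) \<le> (1 - 3 * \<beta>\<^sup>2/20) * \<tau>"
    by (rule power2_le_imp_le) (use \<beta>2 \<tau> in auto)
  hence 1: "norm (y - w) + 3 * c * \<tau> \<le> \<tau>" by (simp add: c\<beta> algebra_simps)
  \<comment> \<open>The sign \<open>e\<close> converts \<open>u\<close> back to \<open>v\<close>.
    Bending and radius together deviate from the axis by at most
    \<open>4 * \<beta>\<^sup>2 * \<tau>\<close>, which is \<open>\<kappa>\<close> times the step
    length by the choice of \<open>\<beta>\<close>.\<close>
  have 2: "norm (y' - x - (e * \<beta> * \<tau>) *\<^sub>R v) < \<kappa> * \<bar>e * \<beta> * \<tau>\<bar>"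
    if "norm (y' - y) < 3 * c * \<tau>" for y'
  proof -
    have eq: "y' - x - (e * \<beta> * \<tau>) *\<^sub>R v = (y' - y) - \<beta>\<^sup>2 *\<^sub>R d"
      by (simp add: y_def eu algebra_simps power2_eq_square)
    have "norm (y' - x - (e * \<beta> * \<tau>) *\<^sub>R v) \<le> norm (y' - y) + \<beta>\<^sup>2 * norm d"
      unfolding eq using norm_triangle_ineq4[of "y' - y" "\<beta>\<^sup>2 *\<^sub>R d"] by simp
    also have "\<dots> < 3 * c * \<tau> + \<beta>\<^sup>2 * ((1 + 2 * c) * \<tau>)"
      using that x \<beta>2 by (intro add_less_le_mono mult_left_mono) (auto simp: d_def)
    also have "\<dots> = \<beta>\<^sup>2 * \<tau> * (3/20 + (1 + \<beta>\<^sup>2/10))" by (simp add: c\<beta> algebra_simps)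
    also have "\<dots> \<le> \<beta>\<^sup>2 * \<tau> * 4" using \<beta>2 \<tau> by (intro mult_left_mono) auto
    also have "\<dots> = \<kappa> * \<bar>e * \<beta> * \<tau>\<bar>" using \<beta> \<tau> eu by (simp add: \<beta>_def abs_mult power2_eq_square)
    finally show ?thesis .
  qed
  show thesis by (rule that[OF 1 2])
qed

subsection \<open>Mean square gaps\<close>

text \<open>Not divided by the measures of \<open>A\<close> and \<open>B\<close>, so that no set has
  to be non-null; the measures reappear as factors in the triangle inequality.\<close>

definition gap :: "('a::euclidean_space \<Rightarrow> real) \<Rightarrow> 'a set \<Rightarrow> 'a set \<Rightarrow> ennreal" where
  "gap f A B = (\<integral>\<^sup>+x. \<integral>\<^sup>+y. ennreal ((f x - f y)\<^sup>2) * indicator A x * indicator B y \<partial>lborel \<partial>lborel)"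

lemma gap_commute:
  assumes [measurable]: "f \<in> borel_measurable borel" "A \<in> sets borel" "B \<in> sets borel"
  shows "gap f A B = gap f B A"
proof -
  have "gap f A B = (\<integral>\<^sup>+y. \<integral>\<^sup>+x. ennreal ((f x - f y)\<^sup>2) * indicator A x * indicator B y \<partial>lborel \<partial>lborel)"
    unfolding gap_def by (rule lborel_pair.Fubini') measurable
  also have "\<dots> = gap f B A"
    unfolding gap_def by (intro nn_integral_cong) (simp add: power2_commute mult_ac)
  finally show ?thesis .
qed

lemma gap_mono:
  assumes "A \<subseteq> A'" "B \<subseteq> B'"
  shows "gap f A B \<le> gap f A' B'"
  unfolding gap_def
  by (intro nn_integral_mono mult_mono) (use assms in \<open>auto split: split_indicator\<close>)

lemma gap_UN_le:
  assumes [measurable]: "f \<in> borel_measurable borel" "B \<in> sets borel"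
    and W: "\<And>p. p \<in> P \<Longrightarrow> W p \<in> sets borel" and P: "finite P" and A: "A \<subseteq> (\<Union>p\<in>P. W p)"
  shows "gap f A B \<le> (\<Sum>p\<in>P. gap f (W p) B)"
proof -
  have "gap f A B \<le> (\<integral>\<^sup>+x. (\<Sum>p\<in>P. \<integral>\<^sup>+y. ennreal ((f x - f y)\<^sup>2) * indicator (W p) x * indicator B y \<partial>lborel) \<partial>lborel)"
    unfolding gap_def
  proof (intro nn_integral_mono)
    fix x
    show "(\<integral>\<^sup>+y. ennreal ((f x - f y)\<^sup>2) * indicator A x * indicator B y \<partial>lborel)
      \<le> (\<Sum>p\<in>P. \<integral>\<^sup>+y. ennreal ((f x - f y)\<^sup>2) * indicator (W p) x * indicator B y \<partial>lborel)"
    proof (cases "x \<in> A")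
      case True
      then obtain p where p: "p \<in> P" "x \<in> W p" using A by auto
      have "(\<integral>\<^sup>+y. ennreal ((f x - f y)\<^sup>2) * indicator A x * indicator B y \<partial>lborel)
        = (\<integral>\<^sup>+y. ennreal ((f x - f y)\<^sup>2) * indicator (W p) x * indicator B y \<partial>lborel)"
        using True p by simp
      also have "\<dots> \<le> (\<Sum>p\<in>P. \<integral>\<^sup>+y. ennreal ((f x - f y)\<^sup>2) * indicator (W p) x * indicator B y \<partial>lborel)"
        using P p(1) by (intro member_le_sum) auto
      finally show ?thesis .
    qed simp
  qed
  also have "\<dots> = (\<Sum>p\<in>P. gap f (W p) B)"
    unfolding gap_def
  proof (rule nn_integral_sum)
    fix p assume "p \<in> P"
    hence [measurable]: "W p \<in> sets borel" by (rule W)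
    show "(\<lambda>x. \<integral>\<^sup>+y. ennreal ((f x - f y)\<^sup>2) * indicator (W p) x * indicator B y \<partial>lborel)
      \<in> borel_measurable lborel" by measurable
  qed
  finally show ?thesis .
qed

text \<open>Integrate \<open>(f x - f z)\<^sup>2 \<le> 2 * (f x - f y)\<^sup>2 + 2 * (f z - f
  y)\<^sup>2\<close> over all triples; the variable absent from a term contributes the measure of
  its set.\<close>

lemma gap_triangle:
  assumes [measurable]: "f \<in> borel_measurable borel" "A \<in> sets borel" "B \<in> sets borel" "C \<in> sets borel"
  shows "emeasure lborel B * gap f A C
    \<le> 2 * emeasure lborel C * gap f A B + 2 * emeasure lborel A * gap f B C"
proof -
  let ?q = "\<lambda>x y. ennreal ((f x - f y)\<^sup>2)"
  have "emeasure lborel B * gap f A C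
    = (\<integral>\<^sup>+x. \<integral>\<^sup>+z. \<integral>\<^sup>+y. ?q x z * indicator A x * indicator C z * indicator B y \<partial>lborel \<partial>lborel \<partial>lborel)"
    unfolding gap_def by (simp add: nn_integral_cmult nn_integral_multc mult.commute)
  also have "\<dots> \<le> (\<integral>\<^sup>+x. \<integral>\<^sup>+z. \<integral>\<^sup>+y. ?q x y * indicator A x * indicator B y * (2 * indicator C z)
      + 2 * indicator A x * (?q z y * indicator C z * indicator B y) \<partial>lborel \<partial>lborel \<partial>lborel)"
  proof (intro nn_integral_mono)
    fix x z y
    \<comment> \<open>Right side minus left side is the square of
      \<open>(f x - f y) + (f z - f y)\<close>.\<close>
    have "(f x - f z)\<^sup>2 \<le> 2 * (f x - f y)\<^sup>2 + 2 * (f z - f y)\<^sup>2"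
      using sum_squares_ge_zero[of "(f x - f y) + (f z - f y)" 0]
      by (simp add: power2_eq_square algebra_simps)
    hence "?q x z \<le> ennreal (2 * (f x - f y)\<^sup>2 + 2 * (f z - f y)\<^sup>2)" by (rule ennreal_leI)
    also have "\<dots> = 2 * ?q x y + 2 * ?q z y" by (simp add: ennreal_plus ennreal_mult)
    finally have "?q x z \<le> 2 * ?q x y + 2 * ?q z y" .
    thus "?q x z * indicator A x * indicator C z * indicator B y
      \<le> ?q x y * indicator A x * indicator B y * (2 * indicator C z)
        + 2 * indicator A x * (?q z y * indicator C z * indicator B y)"
      by (auto split: split_indicator simp: mult.commute)
  qed
  also have "\<dots> = 2 * emeasure lborel C * gap f A B + 2 * emeasure lborel A * gap f C B"
    unfolding gap_def
    by (simp add: nn_integral_add nn_integral_cmult nn_integral_multc mult.commute)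
  finally show ?thesis by (simp add: gap_commute[of f C B])
qed

text \<open>By subadditivity, the piece that meets \<open>A\<close> in the largest measure has at
  least the average share.\<close>

lemma emeasure_pigeonhole:
  assumes I: "finite I" "I \<noteq> {}" "card I \<le> n" and G: "\<And>i. i \<in> I \<Longrightarrow> G i \<in> sets M"
    and A: "A \<in> sets M" "A \<subseteq> (\<Union>i\<in>I. G i)"
  obtains i where "i \<in> I" "emeasure M A \<le> of_nat n * emeasure M (A \<inter> G i)"
proof -
  obtain i where i: "i \<in> I" "\<And>j. j \<in> I \<Longrightarrow> emeasure M (A \<inter> G j) \<le> emeasure M (A \<inter> G i)"
    using finite_imp_Sup_less Max_in[of "(\<lambda>j. emeasure M (A \<inter> G j)) ` I"] Max_ge[of "(\<lambda>j. emeasure M (A \<inter> G j)) ` I"] I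
    by (smt (verit, best) finite_imageI image_iff image_is_empty)
  have "emeasure M A = emeasure M (\<Union>j\<in>I. A \<inter> G j)" using A by (intro arg_cong[where f="emeasure M"]) auto
  also have "\<dots> \<le> (\<Sum>j\<in>I. emeasure M (A \<inter> G j))"
    using I A G by (intro emeasure_subadditive_finite) auto
  also have "\<dots> \<le> of_nat (card I) * emeasure M (A \<inter> G i)" using i(2) by (rule sum_bounded_above)
  also have "\<dots> \<le> of_nat n * emeasure M (A \<inter> G i)" using I(3) by (intro mult_right_mono) auto
  finally show thesis using i(1) that by blast
qed

section \<open>Energy over a set of pairs, and points linked to a set\<close>

definition energy :: "('a::euclidean_space \<Rightarrow> real) \<Rightarrow> ('a \<times> 'a) set \<Rightarrow> 'a set \<Rightarrow> ennreal" where
  "energy f E D = (\<integral>\<^sup>+x. \<integral>\<^sup>+y. ennreal ((f x - f y)\<^sup>2) * indicator E (x, y) * indicator D x * indicator D y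
     \<partial>lborel \<partial>lborel)"

text \<open>Asking for almost every \<open>y\<close> makes this set Borel. With every
  \<open>y\<close> it would be the complement of a projection of a Borel set, which may fail to be
  Borel.\<close>

definition linked :: "('a::euclidean_space \<times> 'a) set \<Rightarrow> 'a set \<Rightarrow> 'a set" where
  "linked E b = {x. AE y in lborel. y \<in> b \<longrightarrow> (x, y) \<in> E}"

text \<open>For \<open>\<kappa> \<le> 1\<close> the balls of radius
  \<open>\<kappa> * \<bar>t\<bar>\<close> around \<open>t *\<^sub>R v\<close> sweep out the open
  double cone whose half-opening has sine \<open>\<kappa>\<close>; negative \<open>t\<close> gives
  the second half. The axis may vary with \<open>x\<close> without any regularity.\<close>

definition contains_double_cones :: "real \<Rightarrow> ('a::euclidean_space \<times> 'a) set \<Rightarrow> bool" where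
  "contains_double_cones \<kappa> E \<longleftrightarrow>
     (\<forall>x. \<exists>v. norm v = 1 \<and> (\<forall>t y. norm (y - x - t *\<^sub>R v) < \<kappa> * \<bar>t\<bar> \<longrightarrow> (x, y) \<in> E))"

text \<open>A point is linked exactly if its section of \<open>UNIV \<times> b - E\<close> is a null
  set, and the measure of a section depends measurably on the point.\<close>

lemma linked_measurable:
  assumes "E \<in> sets borel" "b \<in> sets borel"
  shows "linked E b \<in> sets borel"
proof -
  have E: "E \<in> sets (lborel \<Otimes>\<^sub>M lborel)" using assms(1) by (simp only: lborel_prod sets_lborel)
  have b: "UNIV \<times> b \<in> sets (lborel \<Otimes>\<^sub>M lborel)" using assms(2) by (intro pair_measureI) auto
  have X: "UNIV \<times> b - E \<in> sets (lborel \<Otimes>\<^sub>M lborel)" using E b by auto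
  have "(AE y in lborel. y \<in> b \<longrightarrow> (x, y) \<in> E)
      \<longleftrightarrow> emeasure lborel (Pair x -` (UNIV \<times> b - E)) = 0" for x
  proof -
    have "Pair x -` (UNIV \<times> b - E) \<in> sets lborel" using X by (rule sets_Pair1)
    moreover have "{y \<in> space lborel. \<not> (y \<in> b \<longrightarrow> (x, y) \<in> E)} = Pair x -` (UNIV \<times> b - E)" by auto
    ultimately show ?thesis by (simp add: AE_iff_measurable[OF _ refl])
  qed
  hence "linked E b = (\<lambda>x. emeasure lborel (Pair x -` (UNIV \<times> b - E))) -` {0} \<inter> space lborel"
    by (auto simp: linked_def)
  also have "\<dots> \<in> sets lborel"
    by (rule measurable_sets[OF lborel.measurable_emeasure_Pair[OF X]]) simp
  finally show ?thesis by simp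
qed

text \<open>For \<open>x\<close> in \<open>X\<close> almost every pair with second point in
  \<open>b\<close> belongs to \<open>E\<close>, so the gap integral is a part of the energy.\<close>

lemma gap_linked_le:
  assumes "X \<subseteq> linked E b" "X \<subseteq> D" "b \<subseteq> D"
  shows "gap f X b \<le> energy f E D"
  unfolding gap_def energy_def
proof (rule nn_integral_mono)
  fix x
  show "(\<integral>\<^sup>+y. ennreal ((f x - f y)\<^sup>2) * indicator X x * indicator b y \<partial>lborel)
    \<le> (\<integral>\<^sup>+y. ennreal ((f x - f y)\<^sup>2) * indicator E (x, y) * indicator D x * indicator D y \<partial>lborel)"
  proof (cases "x \<in> X")
    case True
    hence "AE y in lborel. y \<in> b \<longrightarrow> (x, y) \<in> E" using assms by (auto simp: linked_def)
    hence "AE y in lborel. ennreal ((f x - f y)\<^sup>2) * indicator X x * indicator b y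
        \<le> ennreal ((f x - f y)\<^sup>2) * indicator E (x, y) * indicator D x * indicator D y"
      by eventually_elim (use True assms in \<open>auto split: split_indicator\<close>)
    thus ?thesis by (rule nn_integral_mono_AE)
  qed simp
qed

text \<open>One link of a chain: the triangle inequality through \<open>G\<close>, with all volumes
  expressed in the unit \<open>v\<close>, which finally cancels. The set \<open>G\<close> need only
  fill the fraction \<open>1 / l\<close> of a unit.\<close>

lemma gap_chain:
  assumes m: "f \<in> borel_measurable borel" "A \<in> sets borel" "G \<in> sets borel" "A' \<in> sets borel"
    and v: "v \<noteq> 0" "v \<noteq> top" and G: "v \<le> l * emeasure lborel G"
    and A: "emeasure lborel A \<le> h * v" "emeasure lborel A' \<le> h' * v"
    and gaps: "gap f A G \<le> c * Q" "gap f G A' \<le> c' * Q"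
  shows "gap f A A' \<le> 2 * l * (h' * c + h * c') * Q"
proof -
  have "v * gap f A A' \<le> l * emeasure lborel G * gap f A A'" using G by (rule mult_right_mono) simp
  also have "\<dots> = l * (emeasure lborel G * gap f A A')" by (rule mult.assoc)
  also have "\<dots> \<le> l * (2 * emeasure lborel A' * gap f A G + 2 * emeasure lborel A * gap f G A')"
    by (intro mult_left_mono gap_triangle m) simp
  also have "\<dots> \<le> l * (2 * (h' * v) * (c * Q) + 2 * (h * v) * (c' * Q))"
    by (intro mult_left_mono add_mono mult_mono A gaps) simp_all
  also have "\<dots> = v * (2 * l * (h' * c + h * c') * Q)" by (simp add: distrib_left distrib_right mult_ac)
  finally show ?thesis using v by (simp add: ennreal_mult_le_mult_iff)
qed

text \<open>Total boundedness gives one net \<open>P\<close> of a fixed ball; it is then scaled by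
  \<open>s\<close> and shifted to \<open>z\<close>. Its cardinality is therefore the same at all
  scales and positions.\<close>

lemma finite_net_ball:
  fixes r e :: real
  assumes "0 < e"
  obtains P :: "'a::euclidean_space set" where "finite P"
    "\<And>z s y. 0 < s \<Longrightarrow> norm (y - z) < r * s \<Longrightarrow> \<exists>p\<in>(\<lambda>p. z + s *\<^sub>R p) ` P. norm (p - y) < e * s"
proof -
  obtain P :: "'a set" where P: "finite P" "cball 0 r \<subseteq> (\<Union>p\<in>P. ball p e)"
    using compact_cball[of "0::'a" r] assms unfolding compact_eq_totally_bounded by blast
  show thesis
  proof (rule that[OF P(1)])
    fix z y :: 'a and s :: real assume s: "0 < s" and y: "norm (y - z) < r * s"
    have "norm ((1 / s) *\<^sub>R (y - z)) = norm (y - z) / s" using s unfolding norm_scaleR by simp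
    also have "\<dots> \<le> r" using s y by (simp add: field_simps)
    finally have "(1 / s) *\<^sub>R (y - z) \<in> cball 0 r" by (simp only: mem_cball_0)
    then obtain p where p: "p \<in> P" "norm (p - (1 / s) *\<^sub>R (y - z)) < e"
      using P(2) unfolding dist_norm[symmetric] mem_ball[symmetric] by blast
    have "z + s *\<^sub>R p - y = s *\<^sub>R (p - (1 / s) *\<^sub>R (y - z))" using s by (simp add: algebra_simps)
    hence "norm (z + s *\<^sub>R p - y) = s * norm (p - (1 / s) *\<^sub>R (y - z))" using s by simp
    also have "\<dots> < e * s" using p(2) s by (simp add: mult.commute)
    finally show "\<exists>p\<in>(\<lambda>p. z + s *\<^sub>R p) ` P. norm (p - y) < e * s" using p(1) by auto
  qed
qed

lemma emeasure_lborel_ball_scale: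
  fixes p z :: "'a::euclidean_space"
  assumes "0 \<le> a" "0 \<le> r"
  shows "emeasure lborel (ball z (a * r)) = ennreal (a ^ DIM('a)) * emeasure lborel (ball p r)"
  using assms by (simp add: emeasure_ball ennreal_mult power_mult_distrib mult_ac)

subsection \<open>Poincare inequality at one scale\<close>

text \<open>\<open>N\<close> is fixed before position, scale, region, function and pair set, so it
  depends on \<open>\<kappa>\<close> and the dimension only. This holds because the net, the number
  of steps and the volume ratios are all fixed by rescaling to \<open>s = 1\<close>.\<close>

lemma local_poincare:
  fixes \<kappa> :: real
  assumes \<kappa>: "0 < \<kappa>" "\<kappa> \<le> 1"
  obtains N :: nat where "\<And>(z::'a::euclidean_space) s K f E.
    0 < s \<Longrightarrow> convex K \<Longrightarrow> K \<subseteq> ball z (5 * s) \<Longrightarrow> f \<in> borel_measurable borel \<Longrightarrow>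
    E \<in> sets borel \<Longrightarrow> contains_double_cones \<kappa> E \<Longrightarrow>
    gap f (\<Union>k\<in>K. ball k s) (\<Union>k\<in>K. ball k s) \<le> of_nat N * energy f E (\<Union>k\<in>K. ball k s)"
proof -
  define c where "c = \<kappa>\<^sup>2 / 320"
  have c: "0 < c" "c \<le> 1/320" using \<kappa> power_mono[of \<kappa> 1 2] by (auto simp: c_def)
  \<comment> \<open>The radius \<open>6 * s\<close> covers the whole region; the mesh
    \<open>3 * c\<^sup>2 * s\<close> is the length \<open>\<delta>\<close> below.\<close>
  obtain P0 :: "'a set" where P0: "finite P0"
    "\<And>z s y. 0 < s \<Longrightarrow> norm (y - z) < 6 * s \<Longrightarrow> \<exists>p\<in>(\<lambda>p. z + s *\<^sub>R p) ` P0. norm (p - y) < 3 * c\<^sup>2 * s"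
    using finite_net_ball[of "3 * c\<^sup>2" 6] c by auto
  \<comment> \<open>\<open>L\<close> bounds both the number of subsets of the net and the number of
    its points, so it serves in every use of the pigeonhole.\<close>
  define L where "L = (2::nat) ^ card P0"
  have L: "1 \<le> L" "card P0 \<le> L" by (auto simp: L_def intro: less_imp_le less_exp)
  \<comment> \<open>Two centres are at most \<open>12 * s = 4 / c\<^sup>2 * \<delta>\<close> apart,
    so \<open>M\<close> steps of length \<open>\<delta>\<close> connect them. \<open>H\<close>
    bounds the volume of the region in units of a net ball, since
    \<open>6 * s = 2 / c\<^sup>2 * \<delta>\<close>.\<close>
  define M where "M = nat \<lceil>4 / c\<^sup>2\<rceil>"
  define H where "H = nat \<lceil>(2 / c\<^sup>2) ^ DIM('a)\<rceil>"
  \<comment> \<open>The bracket with its factor \<open>2 * L\<close> is the cost of comparing the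
    points linked to one net ball with the reference set; the outer \<open>L\<close> counts net
    balls.\<close>
  define C' where "C' = L * (2 * L * (1 + H * (4 * L) ^ M))"
  show thesis
  proof (rule that[of "2 * L * (H * C' + H * C')"])
    fix z :: 'a and s :: real and K and f :: "'a \<Rightarrow> real" and E :: "('a \<times> 'a) set"
    assume s: "0 < s" and K: "convex K" "K \<subseteq> ball z (5 * s)" and f[measurable]: "f \<in> borel_measurable borel"
      and E: "E \<in> sets borel" "contains_double_cones \<kappa> E"
    define D where "D = (\<Union>k\<in>K. ball k s)"
    define Q where "Q = energy f E D"
    \<comment> \<open>The cone lemma applied in a ball of radius \<open>s\<close> yields a ball of
      radius \<open>\<tau>\<close>; applied again in that ball it yields one of radius
      \<open>3 * \<delta>\<close>, large enough to contain a net ball of radius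
      \<open>\<delta>\<close>.\<close>
    define \<tau> where "\<tau> = 3 * c * s"
    define \<delta> where "\<delta> = c * \<tau>"
    have \<tau>: "0 < \<tau>" "\<tau> \<le> s" using c s by (auto simp: \<tau>_def)
    have \<delta>: "0 < \<delta>" "\<delta> = 3 * c\<^sup>2 * s" using c \<tau> by (auto simp: \<delta>_def \<tau>_def power2_eq_square)
    define P where "P = (\<lambda>p. z + s *\<^sub>R p) ` P0"
    have P: "finite P" "card P \<le> card P0" using P0(1) by (auto simp: P_def card_image_le)
    have Dopen[measurable]: "D \<in> sets borel" unfolding D_def by (intro borel_open open_UN) auto
    have Dball: "D \<subseteq> ball z (6 * s)"
    proof
      fix x assume "x \<in> D"
      then obtain k where k: "k \<in> K" "dist k x < s" by (auto simp: D_def)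
      have "dist z k < 5 * s" using K(2) k(1) by auto
      thus "x \<in> ball z (6 * s)" using k(2) dist_triangle[of z x k] by simp
    qed
    \<comment> \<open>Centres from which a ball of radius \<open>\<tau>\<close> stays in the region.
      As the sum of \<open>K\<close> and a closed ball this set is convex, which allows the ball to
      move along segments.\<close>
    define K' where "K' = {w. \<exists>k\<in>K. norm (w - k) \<le> s - \<tau>}"
    have K'conv: "convex K'"
    proof -
      have "K' = (\<Union>k\<in>K. \<Union>y\<in>cball 0 (s - \<tau>). {k + y})"
      proof (intro set_eqI iffI)
        fix w assume "w \<in> K'"
        then obtain k where k: "k \<in> K" "norm (w - k) \<le> s - \<tau>" by (auto simp: K'_def)
        hence "w - k \<in> cball 0 (s - \<tau>)" "w \<in> {k + (w - k)}" by auto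
        thus "w \<in> (\<Union>k\<in>K. \<Union>y\<in>cball 0 (s - \<tau>). {k + y})" using k(1) by blast
      next
        fix w assume "w \<in> (\<Union>k\<in>K. \<Union>y\<in>cball 0 (s - \<tau>). {k + y})"
        then obtain k y where "k \<in> K" "norm y \<le> s - \<tau>" "w = k + y" by auto
        thus "w \<in> K'" by (auto simp: K'_def intro!: bexI[of _ k])
      qed
      thus ?thesis using convex_sums[OF K(1) convex_cball[of 0 "s - \<tau>"]] by simp
    qed
    have K'D: "ball w \<tau> \<subseteq> D" if w: "w \<in> K'" for w
    proof
      fix x assume x: "x \<in> ball w \<tau>"
      obtain k where k: "k \<in> K" "norm (w - k) \<le> s - \<tau>" using w by (auto simp: K'_def)
      have "dist k x < s" using dist_triangle[of k x w] k(2) x by (simp add: dist_norm norm_minus_commute)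
      thus "x \<in> D" using k(1) by (auto simp: D_def)
    qed
    \<comment> \<open>The cone lemma in terms of \<open>E\<close>, used below with
      \<open>t = s\<close> and with \<open>t = \<tau>\<close>.\<close>
    have cone: "\<exists>y. norm (y - w) + 3 * c * t \<le> t \<and> (\<forall>y'\<in>ball y (3 * c * t). (x, y') \<in> E)"
      if t: "0 < t" and x: "norm (x - w) \<le> (1 + 2 * c) * t" for x w t
    proof -
      obtain v where v: "norm v = 1" "\<And>t y. norm (y - x - t *\<^sub>R v) < \<kappa> * \<bar>t\<bar> \<Longrightarrow> (x, y) \<in> E"
        using E(2) unfolding contains_double_cones_def by meson
      obtain y a where ya: "norm (y - w) + 3 * c * t \<le> t"
        "\<And>y'. norm (y' - y) < 3 * c * t \<Longrightarrow> norm (y' - x - a *\<^sub>R v) < \<kappa> * \<bar>a\<bar>"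
        using ball_in_double_cone[OF \<kappa> c_def v(1) t x] by blast
      have "(x, y') \<in> E" if "y' \<in> ball y (3 * c * t)" for y'
        using that v(2)[OF ya(2), of y'] by (metis mem_ball dist_commute dist_norm)
      thus ?thesis using ya(1) by blast
    qed
    \<comment> \<open>\<open>far\<close> starts the moving ball of radius \<open>\<tau>\<close>, \<open>near\<close> is used for each of its steps of length at most \<open>\<delta>\<close>.\<close>
    have far: "\<exists>w\<in>K'. \<forall>y\<in>ball w \<tau>. (x, y) \<in> E" if "x \<in> D" for x
    proof -
      obtain k where k: "k \<in> K" "dist k x < s" using \<open>x \<in> D\<close> by (auto simp: D_def)
      have "norm (x - k) \<le> (1 + 2 * c) * s"
        using k(2) mult_pos_pos[OF c(1) s] by (simp add: dist_norm norm_minus_commute algebra_simps)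
      from cone[OF s this] obtain w where
        w: "norm (w - k) + \<tau> \<le> s" "\<forall>y\<in>ball w \<tau>. (x, y) \<in> E" by (auto simp: \<tau>_def)
      have "w \<in> K'" using w(1) k(1) by (auto simp: K'_def intro!: bexI[of _ k])
      thus ?thesis using w(2) by blast
    qed
    \<comment> \<open>The moving ball at \<open>w\<close> enters the estimates only through the set
      \<open>V w\<close> of net balls inside it. So infinitely many positions give finitely many
      cases, and every pigeonhole has a bounded number of holes.\<close>
    define W where "W p = linked E (ball p \<delta>)" for p
    have W[measurable]: "W p \<in> sets borel" for p unfolding W_def by (intro linked_measurable E) auto
    define V where "V w = {p \<in> P. ball p \<delta> \<subseteq> ball w \<tau>}" for w
    have VP: "V w \<subseteq> P" "finite (V w)" for w using P(1) by (auto simp: V_def)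
    have near: "\<exists>p\<in>V w. x \<in> W p" if w: "w \<in> K'" and x: "norm (x - w) \<le> \<tau> + 2 * \<delta>" for w x
    proof -
      have "norm (x - w) \<le> (1 + 2 * c) * \<tau>" using x by (simp add: \<delta>_def algebra_simps)
      from cone[OF \<tau>(1) this] obtain y where
        y: "norm (y - w) + 3 * \<delta> \<le> \<tau>" "\<forall>y'\<in>ball y (3 * \<delta>). (x, y') \<in> E"
        by (auto simp: \<delta>_def mult.assoc)
      have "y \<in> ball w \<tau>" using y(1) \<delta>(1) by (simp add: dist_norm norm_minus_commute)
      hence "y \<in> ball z (6 * s)" using K'D[OF w] Dball by blast
      hence "norm (y - z) < 6 * s" by (simp add: dist_norm norm_minus_commute)
      then obtain p where p: "p \<in> P" "norm (p - y) < \<delta>" using P0(2)[OF s] unfolding P_def \<delta>(2) by blast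
      have sub: "ball p \<delta> \<subseteq> ball y (2 * \<delta>)"
        using p(2) by (subst ball_subset_ball_iff) (auto simp: dist_norm)
      have "ball y (2 * \<delta>) \<subseteq> ball w \<tau>"
        using y(1) \<delta>(1) by (subst ball_subset_ball_iff) (auto simp: dist_norm)
      hence "p \<in> V w" using p(1) sub by (auto simp: V_def)
      moreover have "ball p \<delta> \<subseteq> ball y (3 * \<delta>)" using sub \<delta>(1) subset_ball[of "2 * \<delta>" "3 * \<delta>" y] by auto
      hence "x \<in> W p" using y(2) by (auto simp: W_def linked_def intro!: AE_I2)
      ultimately show ?thesis by blast
    qed
    have VD: "ball p \<delta> \<subseteq> D" if "w \<in> K'" "p \<in> V w" for w p using K'D that by (auto simp: V_def)
    define v where "v = emeasure lborel (ball z \<delta>)"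
    have v: "v \<noteq> 0" "v \<noteq> top" "\<And>p::'a. emeasure lborel (ball p \<delta>) = v"
      using \<delta>(1) by (auto simp: v_def emeasure_ball unit_ball_vol_pos[THEN less_imp_neq, symmetric])
    have vH: "emeasure lborel D \<le> of_nat H * v"
    proof -
      have eq: "6 * s = 2 / c\<^sup>2 * \<delta>" using c by (simp add: \<delta>(2))
      have "emeasure lborel D \<le> emeasure lborel (ball z (6 * s))" by (intro emeasure_mono Dball) auto
      also have "\<dots> = ennreal ((2 / c\<^sup>2) ^ DIM('a)) * v"
        unfolding eq v_def using \<delta>(1) by (intro emeasure_lborel_ball_scale) auto
      also have "ennreal ((2 / c\<^sup>2) ^ DIM('a)) \<le> ennreal (real H)"
        unfolding H_def by (intro ennreal_leI) (rule real_nat_ceiling_ge)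
      finally show ?thesis by (simp add: ennreal_of_nat_eq_real_of_nat mult_right_mono)
    qed
    show "gap f (\<Union>k\<in>K. ball k s) (\<Union>k\<in>K. ball k s)
      \<le> of_nat (2 * L * (H * C' + H * C')) * energy f E (\<Union>k\<in>K. ball k s)"
      unfolding D_def[symmetric] Q_def[symmetric]
    proof (cases "K = {}")
      case True
      thus "gap f D D \<le> of_nat (2 * L * (H * C' + H * C')) * Q" by (simp add: D_def gap_def)
    next
      case False
      then obtain k where "k \<in> K" by auto
      hence w1: "k \<in> K'" using \<tau> by (auto simp: K'_def intro!: bexI[of _ k])
      obtain q0 where q0: "q0 \<in> V k" using near[OF w1, of k] \<tau> \<delta>(1) by auto
      \<comment> \<open>The ball provided by \<open>far\<close> depends on the point; only finitely many sets of net balls arise, so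
        one of them serves a fixed fraction of \<open>ball q0 \<delta>\<close>.\<close>
      let ?G = "\<lambda>U. ball q0 \<delta> \<inter> (\<Inter>p\<in>U. W p)"
      have "\<exists>U\<in>V ` K'. v \<le> of_nat L * emeasure lborel (ball q0 \<delta> \<inter> ?G U)"
      proof -
        have sub: "V ` K' \<subseteq> Pow P" using VP by auto
        have fin: "finite (V ` K')" "card (V ` K') \<le> L"
        proof -
          show "finite (V ` K')" using sub P(1) by (auto intro: finite_subset)
          have "card (V ` K') \<le> card (Pow P)" using sub P(1) by (intro card_mono) auto
          also have "\<dots> \<le> L" using P by (auto simp: card_Pow L_def intro: power_increasing)
          finally show "card (V ` K') \<le> L" .
        qed
        have ne: "V ` K' \<noteq> {}" using w1 by auto
        have meas: "?G U \<in> sets lborel" if U: "U \<in> V ` K'" for U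
        proof -
          obtain w where w: "w \<in> K'" "U = V w" using U by auto
          have "U \<noteq> {}" using near[OF w(1), of w] \<tau> \<delta>(1) w(2) by auto
          thus ?thesis using VP(2)[of w] w(2) by (intro sets.Int sets.finite_INT) auto
        qed
        have cov: "ball q0 \<delta> \<subseteq> (\<Union>U\<in>V ` K'. ?G U)"
        proof
          fix x assume x: "x \<in> ball q0 \<delta>"
          hence "x \<in> D" using VD[OF w1 q0] by auto
          then obtain w where w: "w \<in> K'" "\<forall>y\<in>ball w \<tau>. (x, y) \<in> E" using far by blast
          have "x \<in> W p" if "p \<in> V w" for p
            using that w(2) by (auto simp: W_def linked_def V_def intro!: AE_I2)
          thus "x \<in> (\<Union>U\<in>V ` K'. ?G U)" using x w(1) by blast
        qed
        show ?thesis
          using emeasure_pigeonhole[OF fin(1) ne fin(2) meas _ cov] v(3) by (metis lborelD borel_open open_ball sets_lborel)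
      qed
      then obtain w0 where w0: "w0 \<in> K'" "v \<le> of_nat L * emeasure lborel (ball q0 \<delta> \<inter> ?G (V w0))" by blast
      \<comment> \<open>\<open>G0\<close> is the reference set with which everything is compared.
        All its points are linked to all net balls at the position \<open>w0\<close>, where the walk
        therefore starts.\<close>
      define G0 where "G0 = ?G (V w0)"
      have G0[measurable]: "G0 \<in> sets borel"
      proof -
        have "V w0 \<noteq> {}" using near[OF w0(1), of w0] \<tau> \<delta>(1) by auto
        thus ?thesis unfolding G0_def using VP(2)[of w0] by (intro sets.Int sets.finite_INT) auto
      qed
      have G0v: "v \<le> of_nat L * emeasure lborel G0" using w0(2) by (simp add: G0_def Int_absorb1)
      have G0b: "G0 \<subseteq> ball q0 \<delta>" by (auto simp: G0_def)
      have G0D: "G0 \<subseteq> D" using G0b VD[OF w1 q0] by auto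
      have G0le: "emeasure lborel G0 \<le> v"
        using emeasure_mono[OF G0b, of lborel] v(3) by simp
      \<comment> \<open>Induction on the number of steps. Only a fraction \<open>1 / L\<close> of
        each net ball is controlled, but the fraction does not shrink with \<open>i\<close>: each
        step applies the pigeonhole to the whole of the next net ball. Only the constant grows, by
        the factor \<open>4 * L\<close>.\<close>
      have walk: "\<exists>G\<in>sets borel. G \<subseteq> ball q \<delta> \<and> v \<le> of_nat L * emeasure lborel G
          \<and> gap f G G0 \<le> of_nat ((4 * L) ^ i) * Q"
        if "w \<in> K'" "norm (w - w0) \<le> real i * \<delta>" "q \<in> V w" for i w q
        using that
      proof (induction i arbitrary: w q)
        case 0
        hence "q \<in> V w0" by simp
        have "gap f (ball q \<delta>) G0 = gap f G0 (ball q \<delta>)" by (rule gap_commute) auto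
        also have "\<dots> \<le> Q" unfolding Q_def
          using \<open>q \<in> V w0\<close> by (intro gap_linked_le G0D VD[OF w0(1)]) (auto simp: G0_def W_def)
        finally have "gap f (ball q \<delta>) G0 \<le> Q" .
        moreover have "v \<le> of_nat L * v" using mult_right_mono[of 1 "of_nat L" v] L(1) by simp
        ultimately show ?case using v(3) by (intro bexI[of _ "ball q \<delta>"]) auto
      next
        case (Suc i)
        \<comment> \<open>One step of length \<open>\<delta>\<close> back towards \<open>w0\<close>
          on the segment, or \<open>w0\<close> itself if it is that close.\<close>
        define w' where "w' = (if norm (w - w0) \<le> \<delta> then w0 else w + (\<delta> / norm (w - w0)) *\<^sub>R (w0 - w))"
        have w': "w' \<in> K'" "norm (w' - w0) \<le> real i * \<delta>" "norm (w - w') \<le> \<delta>"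
        proof -
          let ?n = "norm (w - w0)"
          have "w' \<in> K' \<and> norm (w' - w0) \<le> real i * \<delta> \<and> norm (w - w') \<le> \<delta>"
          proof (cases "?n \<le> \<delta>")
            case True
            thus ?thesis using w0(1) \<delta>(1) by (simp add: w'_def)
          next
            case False
            let ?a = "\<delta> / ?n"
            have a: "0 \<le> ?a" "?a \<le> 1" "?a * ?n = \<delta>" using False \<delta>(1) by (auto simp: divide_le_eq not_le intro: less_imp_le)
            have eq: "w' = (1 - ?a) *\<^sub>R w + ?a *\<^sub>R w0" using False by (simp add: w'_def algebra_simps)
            have "w' \<in> K'" unfolding eq using Suc.prems(1) w0(1) a by (intro convexD[OF K'conv]) auto
            moreover have "w' - w0 = (1 - ?a) *\<^sub>R (w - w0)" unfolding eq by (simp add: algebra_simps)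
            hence "norm (w' - w0) = (1 - ?a) * ?n" using a by simp
            hence "norm (w' - w0) \<le> real i * \<delta>"
              using a(3) Suc.prems(2) by (simp add: left_diff_distrib distrib_right)
            moreover have "w - w' = ?a *\<^sub>R (w - w0)" unfolding eq by (simp add: algebra_simps)
            hence "norm (w - w') = ?a * ?n" by (simp only: norm_scaleR abs_of_nonneg[OF a(1)])
            hence "norm (w - w') \<le> \<delta>" using a(3) by linarith
            ultimately show ?thesis by blast
          qed
          thus "w' \<in> K'" "norm (w' - w0) \<le> real i * \<delta>" "norm (w - w') \<le> \<delta>" by auto
        qed
        \<comment> \<open>The ball around \<open>q\<close> lies in the moving ball at
          \<open>w\<close>, hence at most \<open>\<delta>\<close> outside the one at
          \<open>w'\<close>, within the tolerance of \<open>near\<close>.\<close>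
        have cov: "ball q \<delta> \<subseteq> (\<Union>p\<in>V w'. W p)"
        proof
          fix x assume x: "x \<in> ball q \<delta>"
          have "x \<in> ball w \<tau>" using Suc.prems(3) x by (auto simp: V_def)
          hence "norm (x - w') \<le> \<tau> + 2 * \<delta>"
            using w'(3) \<delta>(1) norm_triangle_ineq[of "x - w" "w - w'"] by (simp add: dist_norm norm_minus_commute)
          from near[OF w'(1) this] show "x \<in> (\<Union>p\<in>V w'. W p)" by blast
        qed
        have ne: "V w' \<noteq> {}" using near[OF w'(1), of w'] \<tau> \<delta>(1) by auto
        have card: "card (V w') \<le> L" using card_mono[OF P(1) VP(1)[of w']] P(2) L(2) by simp
        obtain p where p: "p \<in> V w'" "v \<le> of_nat L * emeasure lborel (ball q \<delta> \<inter> W p)"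
          using emeasure_pigeonhole[OF VP(2) ne card, of W lborel "ball q \<delta>"] cov v(3) by auto
        let ?G = "ball q \<delta> \<inter> W p"
        obtain G where G[measurable]: "G \<in> sets borel" and G': "G \<subseteq> ball p \<delta>" "v \<le> of_nat L * emeasure lborel G"
            "gap f G G0 \<le> of_nat ((4 * L) ^ i) * Q"
          using Suc.IH[OF w'(1,2) p(1)] by auto
        have "gap f ?G G \<le> gap f ?G (ball p \<delta>)" by (intro gap_mono G') auto
        also have "\<dots> \<le> Q" unfolding Q_def
          using VD[OF Suc.prems(1,3)] by (intro gap_linked_le VD[OF w'(1) p(1)]) (auto simp: W_def)
        finally have 1: "gap f ?G G \<le> 1 * Q" by simp
        have 2: "emeasure lborel ?G \<le> 1 * v"
          using emeasure_mono[of ?G "ball q \<delta>" lborel] v(3) by simp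
        have "gap f ?G G0 \<le> 2 * of_nat L * (1 * 1 + 1 * of_nat ((4 * L) ^ i)) * Q"
          by (rule gap_chain[OF f _ G G0 v(1,2) G'(2) 2 _ 1 G'(3)]) (use G0le in auto)
        also have "2 * of_nat L * (1 * 1 + 1 * of_nat ((4 * L) ^ i)) = (of_nat (2 * L * (1 + (4 * L) ^ i)) :: ennreal)"
          by (simp add: distrib_left)
        also have "\<dots> \<le> of_nat ((4 * L) ^ Suc i)"
        proof -
          have "1 \<le> (4 * L) ^ i" using L(1) by simp
          hence "2 * L * (1 + (4 * L) ^ i) \<le> 2 * L * (2 * (4 * L) ^ i)" by (intro mult_left_mono) auto
          thus ?thesis by (simp only: of_nat_le_iff) (simp add: mult_ac)
        qed
        finally have "gap f ?G G0 \<le> of_nat ((4 * L) ^ Suc i) * Q" by (simp add: mult_right_mono)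
        thus ?case using p(2) by (intro bexI[of _ ?G]) auto
      qed
      \<comment> \<open>A last link passes from net balls to all points of the region linked to one
        of them. This set may be as large as the region, which costs the factor
        \<open>H\<close>.\<close>
      have final: "gap f (D \<inter> W p) G0 \<le> of_nat (2 * L * (1 + H * (4 * L) ^ M)) * Q"
        if w: "w \<in> K'" and p: "p \<in> V w" for w p
      proof -
        have "norm (w - w0) \<le> real M * \<delta>"
        proof -
          have "w \<in> ball z (6 * s)" "w0 \<in> ball z (6 * s)"
            using K'D[OF w] K'D[OF w0(1)] Dball \<tau>(1) by (meson centre_in_ball subsetD)+
          hence "norm (w - w0) \<le> 12 * s"
            using dist_triangle2[of w w0 z] by (simp add: dist_norm norm_minus_commute)
          also have "12 * s = 4 / c\<^sup>2 * \<delta>" using c by (simp add: \<delta>(2))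
          also have "\<dots> \<le> real M * \<delta>"
            unfolding M_def using \<delta>(1) by (intro mult_right_mono real_nat_ceiling_ge) auto
          finally show ?thesis .
        qed
        then obtain G where G[measurable]: "G \<in> sets borel" and G': "G \<subseteq> ball p \<delta>" "v \<le> of_nat L * emeasure lborel G"
            "gap f G G0 \<le> of_nat ((4 * L) ^ M) * Q"
          using walk[OF w _ p] by auto
        have "gap f (D \<inter> W p) G \<le> gap f (D \<inter> W p) (ball p \<delta>)" by (intro gap_mono G') auto
        also have "\<dots> \<le> Q" unfolding Q_def
          by (intro gap_linked_le VD[OF w p]) (auto simp: W_def)
        finally have 1: "gap f (D \<inter> W p) G \<le> 1 * Q" by simp
        have 2: "emeasure lborel (D \<inter> W p) \<le> of_nat H * v"
          using emeasure_mono[of "D \<inter> W p" D lborel] vH by (simp add: order_trans)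
        have "gap f (D \<inter> W p) G0 \<le> 2 * of_nat L * (1 * 1 + of_nat H * of_nat ((4 * L) ^ M)) * Q"
          by (rule gap_chain[OF f _ G G0 v(1,2) G'(2) 2 _ 1 G'(3)]) (use G0le in auto)
        thus ?thesis by (simp add: distrib_left)
      qed
      \<comment> \<open>By \<open>far\<close>, each point of the region is linked to all net balls
        at some position, so the sets \<open>W p\<close> with \<open>p\<close> in \<open>V'\<close>
        cover the region.\<close>
      define V' where "V' = (\<Union>w\<in>K'. V w)"
      have V': "V' \<subseteq> P" "finite V'" using VP P(1) by (auto simp: V'_def intro: finite_subset)
      have "D \<subseteq> (\<Union>p\<in>V'. D \<inter> W p)"
      proof
        fix x assume "x \<in> D"
        then obtain w where w: "w \<in> K'" "\<forall>y\<in>ball w \<tau>. (x, y) \<in> E" using far by blast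
        obtain p where p: "p \<in> V w" using near[OF w(1), of w] \<tau> \<delta>(1) by auto
        hence "x \<in> W p" using w(2) by (auto simp: W_def linked_def V_def intro!: AE_I2)
        thus "x \<in> (\<Union>p\<in>V'. D \<inter> W p)" using \<open>x \<in> D\<close> w(1) p by (auto simp: V'_def)
      qed
      hence "gap f D G0 \<le> (\<Sum>p\<in>V'. gap f (D \<inter> W p) G0)" by (intro gap_UN_le V'(2)) auto
      also have "\<dots> \<le> of_nat (card V') * (of_nat (2 * L * (1 + H * (4 * L) ^ M)) * Q)"
        by (rule sum_bounded_above) (use final in \<open>auto simp: V'_def\<close>)
      also have "\<dots> \<le> of_nat L * (of_nat (2 * L * (1 + H * (4 * L) ^ M)) * Q)"
        using card_mono[OF P(1) V'(1)] P(2) L(2) by (intro mult_right_mono) auto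
      also have "\<dots> = of_nat C' * Q" unfolding C'_def of_nat_mult[of L] by (rule mult.assoc[symmetric])
      finally have 1: "gap f D G0 \<le> of_nat C' * Q" .
      \<comment> \<open>The region is compared with itself through \<open>G0\<close>, using the
        bound for \<open>gap f D G0\<close> on both sides.\<close>
      have "gap f D D \<le> 2 * of_nat L * (of_nat H * of_nat C' + of_nat H * of_nat C') * Q"
        by (rule gap_chain[OF f Dopen G0 Dopen v(1,2) G0v vH vH 1]) (use 1 in \<open>simp add: gap_commute[of f G0 D]\<close>)
      thus "gap f D D \<le> of_nat (2 * L * (H * C' + H * C')) * Q"
        by (simp only: of_nat_mult of_nat_add of_nat_numeral)
    qed
  qed
qed

subsection \<open>Averaging over positions\<close>

lemma energy_eq_nn_integral_pair:
  assumes [measurable]: "f \<in> borel_measurable borel" "D \<in> sets borel" and E: "E \<in> sets borel"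
  shows "energy f E D
    = (\<integral>\<^sup>+p. ennreal ((f (fst p) - f (snd p))\<^sup>2) * indicator E p * indicator (D \<times> D) p \<partial>lborel)"
proof -
  have [measurable]: "E \<in> sets (borel \<Otimes>\<^sub>M borel)" using E by (simp only: borel_prod)
  have "energy f E D = (\<integral>\<^sup>+x. \<integral>\<^sup>+y. (\<lambda>p. ennreal ((f (fst p) - f (snd p))\<^sup>2) * indicator E p
      * indicator (D \<times> D) p) (x, y) \<partial>lborel \<partial>lborel)"
    unfolding energy_def by (intro nn_integral_cong) (auto split: split_indicator)
  also have "\<dots> = (\<integral>\<^sup>+p. ennreal ((f (fst p) - f (snd p))\<^sup>2) * indicator E p
      * indicator (D \<times> D) p \<partial>(lborel \<Otimes>\<^sub>M lborel))"
    by (rule lborel.nn_integral_fst) measurable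
  finally show ?thesis by (simp only: lborel_prod)
qed

lemma gap_eq_energy: "gap f D D = energy f UNIV D"
  by (simp add: gap_def energy_def)

text \<open>A ball with its points at scale \<open>s\<close> near \<open>z\<close>, rounded so that every point of it lies in a ball of
  radius \<open>s\<close> inside.\<close>

definition rounded_cap :: "'a::euclidean_space \<Rightarrow> real \<Rightarrow> real \<Rightarrow> 'a \<Rightarrow> 'a set" where
  "rounded_cap z0 R s z = (\<Union>k\<in>ball z (5 * s) \<inter> cball z0 (R - s). ball k s)"

lemma rounded_cap_subset: "rounded_cap z0 R s z \<subseteq> ball z0 R" "rounded_cap z0 R s z \<subseteq> ball z (6 * s)"
proof -
  have "dist z0 x < R \<and> dist z x < 6 * s" if x: "x \<in> rounded_cap z0 R s z" for x
  proof -
    obtain k where "dist z k < 5 * s" "dist z0 k \<le> R - s" "dist k x < s"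
      using x by (auto simp: rounded_cap_def)
    thus ?thesis using dist_triangle[of z0 x k] dist_triangle[of z x k] by linarith
  qed
  thus "rounded_cap z0 R s z \<subseteq> ball z0 R" "rounded_cap z0 R s z \<subseteq> ball z (6 * s)" by auto
qed

text \<open>If \<open>x\<close> is within \<open>s\<close> of the boundary of the ball, its radial
  projection to the sphere of radius \<open>R - s\<close> serves as centre, otherwise
  \<open>x\<close> itself. The centre is less than \<open>s\<close> away from \<open>x\<close>, so
  less than \<open>5 * s\<close> from \<open>z\<close>.\<close>

lemma mem_rounded_cap:
  assumes s: "0 < s" "s \<le> R" and x: "x \<in> ball z0 R" "dist z x < 4 * s"
  shows "x \<in> rounded_cap z0 R s z"
proof -
  have "\<exists>k. dist z0 k \<le> R - s \<and> dist k x < s"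
  proof (cases "dist z0 x \<le> R - s")
    case True
    thus ?thesis using s by (intro exI[of _ x]) auto
  next
    case False
    define n where "n = norm (x - z0)"
    have n: "R - s < n" "n < R" "0 < n" using False x s by (auto simp: n_def dist_norm norm_minus_commute)
    define k where "k = z0 + ((R - s) / n) *\<^sub>R (x - z0)"
    have "norm (k - z0) = \<bar>(R - s) / n\<bar> * n" unfolding k_def n_def by simp
    hence z0k: "dist z0 k = R - s" using n s by (simp add: dist_norm norm_minus_commute)
    have "x - k = (1 - (R - s) / n) *\<^sub>R (x - z0)" by (simp add: k_def algebra_simps)
    hence "norm (x - k) = \<bar>1 - (R - s) / n\<bar> * n" unfolding n_def by (simp only: norm_scaleR)
    moreover have "0 \<le> 1 - (R - s) / n" using n by (simp add: divide_le_eq)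
    ultimately have "norm (x - k) = (1 - (R - s) / n) * n" by simp
    hence "norm (x - k) = n - (R - s)" using n by (simp add: left_diff_distrib[of 1])
    hence "dist k x < s" using n by (simp add: dist_norm norm_minus_commute)
    thus ?thesis using z0k by (intro exI[of _ k]) simp
  qed
  then obtain k where k: "dist z0 k \<le> R - s" "dist k x < s" by blast
  hence "dist z k < 5 * s" using x(2) dist_triangle2[of z k x] by linarith
  thus ?thesis using k by (auto simp: rounded_cap_def)
qed

text \<open>Integrate the local inequality over \<open>z\<close>. A pair at distance at most
  \<open>2 * s\<close> lies in the cap of every \<open>z\<close> in \<open>ball x (2 * s)\<close>;
  conversely, a cap containing the pair has \<open>z\<close> in \<open>ball x (6 * s)\<close> and
  forces distance at most \<open>12 * s\<close>. The ratio of the two volumes is the factor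
  \<open>3 ^ DIM('a)\<close>.\<close>

lemma scale_poincare:
  fixes z0 :: "'a::euclidean_space" and f :: "'a \<Rightarrow> real" and E :: "('a \<times> 'a) set"
  assumes loc: "\<And>(z::'a) s K f E. 0 < s \<Longrightarrow> convex K \<Longrightarrow> K \<subseteq> ball z (5 * s) \<Longrightarrow> f \<in> borel_measurable borel \<Longrightarrow>
      E \<in> sets borel \<Longrightarrow> contains_double_cones \<kappa> E \<Longrightarrow>
      gap f (\<Union>k\<in>K. ball k s) (\<Union>k\<in>K. ball k s) \<le> of_nat N * energy f E (\<Union>k\<in>K. ball k s)"
    and s: "0 < s" "s \<le> R" and f[measurable]: "f \<in> borel_measurable borel"
    and E: "E \<in> sets borel" "contains_double_cones \<kappa> E"
  shows "(\<integral>\<^sup>+p. ennreal ((f (fst p) - f (snd p))\<^sup>2) * indicator (ball z0 R \<times> ball z0 R) p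
        * indicator {p. dist (fst p) (snd p) \<le> 2 * s} p \<partial>lborel)
    \<le> of_nat (N * 3 ^ DIM('a)) * (\<integral>\<^sup>+p. ennreal ((f (fst p) - f (snd p))\<^sup>2) * indicator E p
        * indicator (ball z0 R \<times> ball z0 R) p * indicator {p. dist (fst p) (snd p) \<le> 12 * s} p \<partial>lborel)"
    (is "?l \<le> _ * ?r")
proof -
  let ?q = "\<lambda>p. ennreal ((f (fst p) - f (snd p))\<^sup>2)"
  let ?B = "ball z0 R \<times> ball z0 R"
  let ?D = "rounded_cap z0 R s"
  have Em[measurable]: "E \<in> sets (borel \<Otimes>\<^sub>M borel)" using E(1) by (simp only: borel_prod)
  have qm: "(\<lambda>p. ?q p * indicator F p) \<in> borel_measurable borel" if "F \<in> sets borel" for F :: "('a \<times> 'a) set"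
  proof -
    have [measurable]: "F \<in> sets (borel \<Otimes>\<^sub>M borel)" using that by (simp only: borel_prod)
    have "(\<lambda>p. ?q p * indicator F p) \<in> borel_measurable (borel \<Otimes>\<^sub>M borel)" by measurable
    thus ?thesis by (simp only: borel_prod)
  qed
  have Dm: "?D z \<in> sets borel" for z unfolding rounded_cap_def by (intro borel_open open_UN) auto
  \<comment> \<open>Membership in the cap is jointly measurable in position and point:
    \<open>S\<close> is a union of products of open balls, hence open.\<close>
  define S where "S = {(z, x). x \<in> ?D z}"
  have "S = (\<Union>k\<in>cball z0 (R - s). ball k (5 * s) \<times> ball k s)"
    by (auto simp: S_def rounded_cap_def dist_commute)
  hence "open S" by (auto intro!: open_Times)
  hence "S \<in> sets borel" by (rule borel_open)
  hence [measurable]: "S \<in> sets (borel \<Otimes>\<^sub>M borel)" by (simp only: borel_prod)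
  define g :: "'a \<Rightarrow> 'a \<times> 'a \<Rightarrow> ennreal"
    where "g z p = indicator S (z, fst p) * indicator S (z, snd p)" for z p
  have ind: "indicator (?D z \<times> ?D z) p = g z p" for z p
    unfolding g_def by (cases p) (auto simp: S_def split: split_indicator)
  have sm[measurable]: "case_prod g \<in> borel_measurable (lborel \<Otimes>\<^sub>M lborel)"
  proof -
    have m: "case_prod g \<in> borel_measurable (borel \<Otimes>\<^sub>M (borel \<Otimes>\<^sub>M borel))" unfolding g_def by measurable
    have eq: "sets (lborel \<Otimes>\<^sub>M (lborel :: ('a \<times> 'a) measure)) = sets (borel \<Otimes>\<^sub>M (borel \<Otimes>\<^sub>M borel))"
      by (intro sets_pair_measure_cong) (simp_all only: sets_lborel borel_prod)
    show ?thesis using m by (subst measurable_cong_sets[OF eq refl])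
  qed
  \<comment> \<open>Tonelli: each pair is weighted by the volume of the positions whose cap contains
    it.\<close>
  have swap: "(\<integral>\<^sup>+z. energy f F (?D z) \<partial>lborel)
      = (\<integral>\<^sup>+p. ?q p * indicator F p * (\<integral>\<^sup>+z. indicator (?D z \<times> ?D z) p \<partial>lborel) \<partial>lborel)"
    if F: "F \<in> sets borel" for F
  proof -
    define h where "h = (\<lambda>p. ?q p * indicator F p)"
    have h[measurable]: "h \<in> borel_measurable lborel" using qm[OF F] by (simp add: h_def)
    have hg: "(\<lambda>x. h (snd x) * case_prod g x) \<in> borel_measurable (lborel \<Otimes>\<^sub>M lborel)"
      by (intro borel_measurable_times_ennreal sm measurable_compose[OF measurable_snd h])
    have "(\<integral>\<^sup>+z. energy f F (?D z) \<partial>lborel) = (\<integral>\<^sup>+z. \<integral>\<^sup>+p. h p * g z p \<partial>lborel \<partial>lborel)"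
      by (simp add: energy_eq_nn_integral_pair[OF f Dm F] ind h_def)
    also have "\<dots> = (\<integral>\<^sup>+p. \<integral>\<^sup>+z. h p * g z p \<partial>lborel \<partial>lborel)"
      using hg by (intro lborel_pair.Fubini') (simp add: case_prod_beta')
    also have "\<dots> = (\<integral>\<^sup>+p. ?q p * indicator F p * (\<integral>\<^sup>+z. indicator (?D z \<times> ?D z) p \<partial>lborel) \<partial>lborel)"
      unfolding ind using h_def measurable_compose[OF measurable_Pair2' sm]
      by (intro nn_integral_cong) (simp add: nn_integral_cmult)
    finally show ?thesis .
  qed
  define v where "v = emeasure lborel (ball z0 (2 * s))"
  have v: "v \<noteq> 0" "v \<noteq> top" "\<And>x::'a. emeasure lborel (ball x (2 * s)) = v"
    using s by (auto simp: v_def emeasure_ball unit_ball_vol_pos[THEN less_imp_neq, symmetric])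
  have v6: "emeasure lborel (ball x (6 * s)) = of_nat (3 ^ DIM('a)) * v" for x :: 'a
  proof -
    have "emeasure lborel (ball x (3 * (2 * s))) = ennreal (3 ^ DIM('a)) * v"
      unfolding v_def using s by (intro emeasure_lborel_ball_scale) auto
    thus ?thesis by (simp flip: ennreal_power)
  qed
  have "v * ?l = (\<integral>\<^sup>+p. v * (?q p * indicator (?B \<inter> {p. dist (fst p) (snd p) \<le> 2 * s}) p) \<partial>lborel)"
  proof (subst nn_integral_cmult)
    have "closed {p :: 'a \<times> 'a. dist (fst p) (snd p) \<le> 2 * s}"
      by (intro closed_Collect_le continuous_intros)
    moreover have "open ?B" by (intro open_Times) auto
    ultimately have "?B \<inter> {p. dist (fst p) (snd p) \<le> 2 * s} \<in> sets borel" by auto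
    thus "(\<lambda>p. ?q p * indicator (?B \<inter> {p. dist (fst p) (snd p) \<le> 2 * s}) p) \<in> borel_measurable lborel"
      using qm by simp
  qed (simp add: indicator_inter_arith mult.assoc)
  also have "\<dots> \<le> (\<integral>\<^sup>+p. ?q p * indicator UNIV p * (\<integral>\<^sup>+z. indicator (?D z \<times> ?D z) p \<partial>lborel) \<partial>lborel)"
  proof (intro nn_integral_mono)
    fix p :: "'a \<times> 'a"
    show "v * (?q p * indicator (?B \<inter> {p. dist (fst p) (snd p) \<le> 2 * s}) p)
      \<le> ?q p * indicator UNIV p * (\<integral>\<^sup>+z. indicator (?D z \<times> ?D z) p \<partial>lborel)"
    proof (cases "p \<in> ?B \<inter> {p. dist (fst p) (snd p) \<le> 2 * s}")
      case True
      obtain x y where p: "p = (x, y)" by (cases p)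
      have xy: "x \<in> ball z0 R" "y \<in> ball z0 R" "dist x y \<le> 2 * s" using True p by auto
      have "p \<in> ?D z \<times> ?D z" if "z \<in> ball x (2 * s)" for z
        using mem_rounded_cap[OF s xy(1), of z] mem_rounded_cap[OF s xy(2), of z] xy(3) that p s(1)
          dist_triangle[of z y x] by (auto simp: dist_commute)
      hence "(\<integral>\<^sup>+z. indicator (ball x (2 * s)) z \<partial>lborel) \<le> (\<integral>\<^sup>+z. indicator (?D z \<times> ?D z) p \<partial>lborel)"
        by (intro nn_integral_mono) (auto split: split_indicator)
      hence "v \<le> (\<integral>\<^sup>+z. indicator (?D z \<times> ?D z) p \<partial>lborel)" by (simp add: v(3))
      from mult_left_mono[OF this, of "?q p"] True show ?thesis by (simp add: mult.commute)
    qed simp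
  qed
  also have "\<dots> = (\<integral>\<^sup>+z. gap f (?D z) (?D z) \<partial>lborel)" 
    unfolding gap_eq_energy by (rule swap[symmetric]) simp
  \<comment> \<open>The local inequality applies since the set of centres of a cap is an
    intersection of two balls, hence convex.\<close>
  also have "\<dots> \<le> (\<integral>\<^sup>+z. of_nat N * energy f E (?D z) \<partial>lborel)"
    unfolding rounded_cap_def
    by (intro nn_integral_mono loc[where z = z for z] s f E convex_Int) auto
  also have "\<dots> = of_nat N * (\<integral>\<^sup>+z. energy f E (?D z) \<partial>lborel)"
  proof (rule nn_integral_cmult)
    define h where "h = (\<lambda>p. ?q p * indicator E p)"
    have h[measurable]: "h \<in> borel_measurable lborel" using qm[OF E(1)] by (simp add: h_def)
    have hg: "(\<lambda>x. h (snd x) * case_prod g x) \<in> borel_measurable (lborel \<Otimes>\<^sub>M lborel)"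
      by (intro borel_measurable_times_ennreal sm measurable_compose[OF measurable_snd h])
    have "(\<lambda>z. \<integral>\<^sup>+p. h p * g z p \<partial>lborel) \<in> borel_measurable lborel"
      using hg by (intro lborel.borel_measurable_nn_integral) (simp add: case_prod_beta')
    thus "(\<lambda>z. energy f E (?D z)) \<in> borel_measurable lborel"
      by (simp add: energy_eq_nn_integral_pair[OF f Dm E(1)] ind h_def)
  qed
  also have "\<dots> = of_nat N * (\<integral>\<^sup>+p. ?q p * indicator E p * (\<integral>\<^sup>+z. indicator (?D z \<times> ?D z) p \<partial>lborel) \<partial>lborel)"
    by (simp only: swap[OF E(1)])
  also have "\<dots> \<le> of_nat N * (\<integral>\<^sup>+p. (of_nat (3 ^ DIM('a)) * v) * (?q p * indicator E p * indicator ?B p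
      * indicator {p. dist (fst p) (snd p) \<le> 12 * s} p) \<partial>lborel)"
  proof (intro mult_left_mono nn_integral_mono)
    fix p :: "'a \<times> 'a"
    obtain x y where p: "p = (x, y)" by (cases p)
    have "(\<integral>\<^sup>+z. indicator (?D z \<times> ?D z) p \<partial>lborel) \<le> (\<integral>\<^sup>+z. indicator (ball x (6 * s)) z
        * indicator (?B \<inter> {p. dist (fst p) (snd p) \<le> 12 * s}) p \<partial>lborel)"
    proof (intro nn_integral_mono)
      fix z
      have "z \<in> ball x (6 * s) \<and> p \<in> ?B \<inter> {p. dist (fst p) (snd p) \<le> 12 * s}" if "p \<in> ?D z \<times> ?D z"
      proof -
        have "x \<in> ?D z" "y \<in> ?D z" using that p by auto
        hence "x \<in> ball z0 R" "y \<in> ball z0 R" "x \<in> ball z (6 * s)" "y \<in> ball z (6 * s)"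
          using rounded_cap_subset[of z0 R s z] by blast+
        thus ?thesis using dist_triangle3[of x y z] by (simp add: p dist_commute)
      qed
      thus "indicator (?D z \<times> ?D z) p \<le> (indicator (ball x (6 * s)) z
        * indicator (?B \<inter> {p. dist (fst p) (snd p) \<le> 12 * s}) p :: ennreal)"
        by (auto split: split_indicator)
    qed
    also have "\<dots> = of_nat (3 ^ DIM('a)) * v * indicator (?B \<inter> {p. dist (fst p) (snd p) \<le> 12 * s}) p"
    proof (subst nn_integral_multc)
      have "integral\<^sup>N lborel (indicator (ball x (6 * s))) = of_nat (3 ^ DIM('a)) * v"
        unfolding v6[of x, symmetric] by (rule nn_integral_indicator) simp
      thus "integral\<^sup>N lborel (indicator (ball x (6 * s))) * indicator (?B \<inter> {p. dist (fst p) (snd p) \<le> 12 * s}) p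
        = of_nat (3 ^ DIM('a)) * v * (indicator (?B \<inter> {p. dist (fst p) (snd p) \<le> 12 * s}) p :: ennreal)" by simp
    qed (auto intro!: borel_measurable_indicator)
    finally have "?q p * indicator E p * (\<integral>\<^sup>+z. indicator (?D z \<times> ?D z) p \<partial>lborel)
        \<le> ?q p * indicator E p * (of_nat (3 ^ DIM('a)) * v * indicator (?B \<inter> {p. dist (fst p) (snd p) \<le> 12 * s}) p)"
      by (rule mult_left_mono) simp
    thus "?q p * indicator E p * (\<integral>\<^sup>+z. indicator (?D z \<times> ?D z) p \<partial>lborel)
        \<le> (of_nat (3 ^ DIM('a)) * v) * (?q p * indicator E p * indicator ?B p
      * indicator {p. dist (fst p) (snd p) \<le> 12 * s} p)"
      by (simp add: indicator_inter_arith mult_ac)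
  qed simp
  also have "\<dots> = of_nat N * ((of_nat (3 ^ DIM('a)) * v) * ?r)"
  proof (subst nn_integral_cmult)
    have "closed {p :: 'a \<times> 'a. dist (fst p) (snd p) \<le> 12 * s}"
      by (intro closed_Collect_le continuous_intros)
    moreover have "open ?B" by (intro open_Times) auto
    ultimately have "E \<inter> (?B \<inter> {p. dist (fst p) (snd p) \<le> 12 * s}) \<in> sets borel" using E(1) by auto
    from qm[OF this] show "(\<lambda>p. ?q p * indicator E p * indicator ?B p
      * indicator {p. dist (fst p) (snd p) \<le> 12 * s} p) \<in> borel_measurable lborel"
      by (simp add: indicator_inter_arith mult.assoc)
  qed simp
  also have "\<dots> = v * (of_nat (N * 3 ^ DIM('a)) * ?r)" by (simp add: mult_ac)
  finally show ?thesis using v by (simp add: ennreal_mult_le_mult_iff)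
qed

subsection \<open>Summation over scales\<close>

text \<open>Take the first dyadic scale below \<open>t\<close>; the scale before it is not below
  \<open>t\<close>. If the first one is \<open>R\<close> itself, the bound is the assumption
  \<open>t \<le> 2 * R\<close>.\<close>

lemma ex_dyadic_scale:
  fixes t R :: real
  assumes "0 < t" "t \<le> 2 * R"
  obtains j :: nat where "R / 2 ^ j < t" "t \<le> 2 * (R / 2 ^ j)"
proof -
  have "0 < R" using assms by linarith
  obtain n where "R / t < 2 ^ n" using real_arch_pow[of 2 "R / t"] by auto
  hence ex: "\<exists>n::nat. R / 2 ^ n < t" using assms(1) by (auto simp: field_simps)
  define j where "j = (LEAST n::nat. R / 2 ^ n < t)"
  have j: "R / 2 ^ j < t" unfolding j_def by (rule LeastI_ex[OF ex])
  have "t \<le> 2 * (R / 2 ^ j)"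
  proof (cases j)
    case 0
    thus ?thesis using assms(2) by simp
  next
    case (Suc m)
    hence "\<not> R / 2 ^ m < t" using not_less_Least[of m "\<lambda>n. R / 2 ^ n < t"] by (simp add: j_def)
    thus ?thesis using Suc by simp
  qed
  thus thesis using j that by blast
qed

text \<open>As \<open>a \<ge> 1\<close>, the weights at least double when the scale is halved. Their
  sum over scales down to \<open>t / 12\<close> is thus at most twice the last one, with a factor 2
  that is uniform in \<open>a\<close>.\<close>

lemma suminf_dyadic_powr_le:
  fixes t R a :: real
  assumes t: "0 < t" and R: "0 < R" and a: "1 \<le> a"
  shows "(\<Sum>j. ennreal ((R / 2 ^ j) powr (- a)) * indicator {s. t \<le> 12 * s} (R / 2 ^ j))
    \<le> ennreal (2 * 12 powr a * t powr (- a))"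
proof -
  define g where "g j = (R / 2 ^ j) powr (- a)" for j :: nat
  have g0: "0 \<le> g j" for j by (simp add: g_def)
  have g_Suc: "2 * g j \<le> g (Suc j)" for j
  proof -
    have "g (Suc j) = (R / 2 ^ j * (1 / 2)) powr (- a)" by (simp add: g_def mult.commute)
    also have "\<dots> = g j * (1 / 2) powr (- a)" using R by (subst powr_mult) (auto simp: g_def)
    also have "(1 / 2 :: real) powr (- a) = 2 powr a" by (simp add: powr_divide powr_minus)
    also have "g j * 2 powr a \<ge> g j * 2" using a powr_mono[of 1 a 2] g0[of j] by (intro mult_left_mono) auto
    finally show ?thesis by simp
  qed
  have g_sum: "(\<Sum>j\<le>m. g j) \<le> 2 * g m" for m
  proof (induction m)
    case (Suc m)
    thus ?case using g_Suc[of m] by simp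
  qed (use g0[of 0] in simp)
  define J where "J = {j::nat. t \<le> 12 * (R / 2 ^ j)}"
  obtain n where n: "12 * R / t < 2 ^ n" using real_arch_pow[of 2 "12 * R / t"] by auto
  have J: "J \<subseteq> {..n}"
  proof
    fix j assume "j \<in> J"
    hence "2 ^ j \<le> 12 * R / t" using t by (simp add: J_def field_simps)
    hence "(2::real) ^ j < 2 ^ n" using n by linarith
    thus "j \<in> {..n}" by simp
  qed
  hence fin: "finite J" by (rule finite_subset) simp
  have "(\<Sum>j. ennreal ((R / 2 ^ j) powr (- a)) * indicator {s. t \<le> 12 * s} (R / 2 ^ j))
      = (\<Sum>j\<in>J. ennreal ((R / 2 ^ j) powr (- a)) * indicator {s. t \<le> 12 * s} (R / 2 ^ j))"
    by (rule suminf_finite[OF fin]) (simp add: J_def)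
  also have "\<dots> = (\<Sum>j\<in>J. ennreal (g j))" by (intro sum.cong) (auto simp: J_def g_def)
  also have "\<dots> = ennreal (\<Sum>j\<in>J. g j)" by (rule sum_ennreal) (rule g0)
  also have "\<dots> \<le> ennreal (2 * 12 powr a * t powr (- a))"
  proof (cases "J = {}")
    case False
    \<comment> \<open>The index of the smallest scale that is still at least
      \<open>t / 12\<close>.\<close>
    define m where "m = Max J"
    have m: "m \<in> J" "J \<subseteq> {..m}" using False fin by (auto simp: m_def)
    have "(\<Sum>j\<in>J. g j) \<le> (\<Sum>j\<le>m. g j)" using m(2) g0 by (intro sum_mono2) auto
    also have "\<dots> \<le> 2 * g m" by (rule g_sum)
    also have "g m \<le> (t / 12) powr (- a)"
    proof -
      have "t \<le> 12 * (R / 2 ^ m)" using m(1) unfolding J_def by blast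
      hence "t / 12 \<le> R / 2 ^ m" by linarith
      thus ?thesis unfolding g_def using t a by (intro powr_mono2') auto
    qed
    also have "(t / 12) powr (- a) = 12 powr a * t powr (- a)"
      using t by (simp add: powr_divide powr_minus field_simps)
    finally show ?thesis by (intro ennreal_leI) (simp add: mult.assoc)
  qed simp
  finally show ?thesis .
qed

lemma gap_measurable:
  assumes "f \<in> borel_measurable (borel :: 'a::euclidean_space measure)"
  shows "(\<lambda>p. ennreal ((f (fst p) - f (snd p))\<^sup>2)) \<in> borel_measurable borel"
proof -
  note assms[measurable]
  have "(\<lambda>p. ennreal ((f (fst p) - f (snd p))\<^sup>2)) \<in> borel_measurable (borel \<Otimes>\<^sub>M borel)" by measurable
  thus ?thesis by (simp only: borel_prod)
qed

lemma frac_kernel_measurable: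
  "(\<lambda>p. frac_kernel \<alpha> (fst p) (snd p)) \<in> borel_measurable (borel :: ((real^'n) \<times> (real^'n)) measure)"
proof -
  have "(\<lambda>p. frac_kernel \<alpha> (fst p) (snd p)) \<in> borel_measurable (borel \<Otimes>\<^sub>M (borel :: (real^'n) measure))"
    unfolding frac_kernel_def by measurable
  thus ?thesis by (simp only: borel_prod)
qed

text \<open>The kernel is comparable to a sum of dyadic weights: it is at most the weight of some
  scale with \<open>t \<le> 2 * s\<close>, and the weights of all scales with
  \<open>t \<le> 12 * s\<close> add up to at most a constant times the kernel. These are the two
  distance bounds of the inequality at one scale.\<close>

lemma kernel_poincare:
  fixes \<kappa> :: real
  assumes \<kappa>: "0 < \<kappa>" "\<kappa> \<le> 1"
  obtains C :: real where "0 \<le> C"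
    "\<And>\<alpha> R (z::real^'n) (f :: real^'n \<Rightarrow> real) E. 0 < \<alpha> \<Longrightarrow> \<alpha> < 2 \<Longrightarrow> 0 < R \<Longrightarrow> f \<in> borel_measurable borel \<Longrightarrow>
      E \<in> sets borel \<Longrightarrow> contains_double_cones \<kappa> E \<Longrightarrow>
      (\<integral>\<^sup>+p. ennreal ((f (fst p) - f (snd p))\<^sup>2) * indicator (ball z R \<times> ball z R) p
          * frac_kernel \<alpha> (fst p) (snd p) \<partial>lborel)
      \<le> ennreal C * (\<integral>\<^sup>+p. ennreal ((f (fst p) - f (snd p))\<^sup>2) * indicator E p
          * indicator (ball z R \<times> ball z R) p * frac_kernel \<alpha> (fst p) (snd p) \<partial>lborel)"
proof -
  obtain N :: nat where N: "\<And>(z::real^'n) s K f E.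
    0 < s \<Longrightarrow> convex K \<Longrightarrow> K \<subseteq> ball z (5 * s) \<Longrightarrow> f \<in> borel_measurable borel \<Longrightarrow>
    E \<in> sets borel \<Longrightarrow> contains_double_cones \<kappa> E \<Longrightarrow>
    gap f (\<Union>k\<in>K. ball k s) (\<Union>k\<in>K. ball k s) \<le> of_nat N * energy f E (\<Union>k\<in>K. ball k s)"
    using local_poincare[OF \<kappa>] by blast
  define N' where "N' = N * 3 ^ DIM(real^'n)"
  \<comment> \<open>The exponent bounds \<open>CARD('n) + \<alpha>\<close> for all
    \<open>\<alpha> < 2\<close>, so \<open>C\<close> does not depend on
    \<open>\<alpha>\<close>.\<close>
  define C where "C = real N' * (2 * 12 powr (real CARD('n) + 2))"
  show thesis
  proof (rule that[of C])
    show "0 \<le> C" by (simp add: C_def)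
    fix \<alpha> R :: real and z :: "real^'n" and f :: "real^'n \<Rightarrow> real" and E :: "((real^'n) \<times> (real^'n)) set"
    assume \<alpha>: "0 < \<alpha>" "\<alpha> < 2" and R: "0 < R" and f: "f \<in> borel_measurable borel"
      and E: "E \<in> sets borel" "contains_double_cones \<kappa> E"
    define a where "a = real CARD('n) + \<alpha>"
    have a: "1 \<le> a" "a \<le> real CARD('n) + 2" 
    proof -
      have "1 \<le> real CARD('n)" by (simp add: Suc_leI)
      thus "1 \<le> a" "a \<le> real CARD('n) + 2" using \<alpha> unfolding a_def by linarith+
    qed
    let ?q = "\<lambda>p. ennreal ((f (fst p) - f (snd p))\<^sup>2)"
    let ?B = "ball z R \<times> ball z R"
    let ?k = "\<lambda>p. frac_kernel \<alpha> (fst p) (snd p)"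
    let ?s = "\<lambda>j::nat. R / 2 ^ j"
    define c where "c j = ennreal (?s j powr (- a))" for j
    define near where "near t = {p :: (real^'n) \<times> (real^'n). dist (fst p) (snd p) \<le> t}" for t
    have qm: "(\<lambda>p. ?q p * indicator F p) \<in> borel_measurable lborel" if "F \<in> sets borel" for F
    proof -
      have "(\<lambda>p. ?q p * indicator F p) \<in> borel_measurable borel"
        by (intro borel_measurable_times_ennreal gap_measurable f borel_measurable_indicator that)
      thus ?thesis by simp
    qed
    have Bm: "?B \<in> sets borel" by (intro borel_open open_Times) auto
    have near_m: "near t \<in> sets borel" for t
      unfolding near_def by (intro borel_closed closed_Collect_le continuous_intros)
    have m1: "(\<lambda>p. ?q p * indicator ?B p * indicator (near t) p) \<in> borel_measurable lborel" for t
      using qm[of "?B \<inter> near t"] Bm near_m by (simp add: indicator_inter_arith mult.assoc)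
    have m2: "(\<lambda>p. ?q p * indicator E p * indicator ?B p * indicator (near t) p) \<in> borel_measurable lborel" for t
      using qm[of "E \<inter> (?B \<inter> near t)"] Bm near_m E by (simp add: indicator_inter_arith mult.assoc)
    have "(\<integral>\<^sup>+p. ?q p * indicator ?B p * ?k p \<partial>lborel)
      \<le> (\<integral>\<^sup>+p. (\<Sum>j. c j * (?q p * indicator ?B p * indicator (near (2 * ?s j)) p)) \<partial>lborel)"
    proof (intro nn_integral_mono)
      fix p :: "(real^'n) \<times> (real^'n)"
      show "?q p * indicator ?B p * ?k p \<le> (\<Sum>j. c j * (?q p * indicator ?B p * indicator (near (2 * ?s j)) p))"
      proof (cases "p \<in> ?B \<and> fst p \<noteq> snd p")
        case True
        define t where "t = norm (fst p - snd p)"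
        have "0 < t" using True by (simp add: t_def)
        moreover have "t \<le> 2 * R"
        proof -
          have "dist z (fst p) < R" "dist z (snd p) < R" using True by (auto simp: mem_Times_iff)
          thus ?thesis using dist_triangle3[of "fst p" "snd p" z] by (simp add: t_def dist_norm)
        qed
        ultimately obtain j where j: "?s j < t" "t \<le> 2 * ?s j" by (rule ex_dyadic_scale)
        have "?k p = ennreal (t powr (- a))" using True by (simp add: frac_kernel_def t_def a_def)
        also have "\<dots> \<le> c j" unfolding c_def using j R a by (intro ennreal_leI powr_mono2') auto
        finally have "?q p * indicator ?B p * ?k p \<le> c j * (?q p * indicator ?B p * indicator (near (2 * ?s j)) p)"
          using True j(2) mult_left_mono[of "?k p" "c j" "?q p"]
          by (simp add: near_def t_def dist_norm mult.commute)
        also have "\<dots> \<le> (\<Sum>j. c j * (?q p * indicator ?B p * indicator (near (2 * ?s j)) p))"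
          using sum_le_suminf[of "\<lambda>j. c j * (?q p * indicator ?B p * indicator (near (2 * ?s j)) p)" "{j}"] by simp
        finally show ?thesis .
      next
        case False
        \<comment> \<open>On the diagonal the squared difference vanishes, so the infinite kernel
          contributes nothing there.\<close>
        hence "?q p * indicator ?B p = 0" by auto
        thus ?thesis by (simp only: mult_zero_left zero_le)
      qed
    qed
    also have "\<dots> = (\<Sum>j. c j * (\<integral>\<^sup>+p. ?q p * indicator ?B p * indicator (near (2 * ?s j)) p \<partial>lborel))"
      using m1 by (subst nn_integral_suminf) (simp_all add: nn_integral_cmult)
    also have "\<dots> \<le> (\<Sum>j. c j * (of_nat N' * (\<integral>\<^sup>+p. ?q p * indicator E p * indicator ?B p * indicator (near (12 * ?s j)) p \<partial>lborel)))"
      unfolding near_def N'_def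
      by (intro suminf_le mult_left_mono scale_poincare[where \<kappa> = \<kappa>] N f E) (use R in \<open>auto simp: divide_le_eq\<close>)
    also have "\<dots> = (\<integral>\<^sup>+p. (\<Sum>j. c j * (of_nat N' * (?q p * indicator E p * indicator ?B p * indicator (near (12 * ?s j)) p))) \<partial>lborel)"
      using m2 by (subst nn_integral_suminf) (simp_all add: nn_integral_cmult)
    also have "\<dots> \<le> (\<integral>\<^sup>+p. ennreal C * (?q p * indicator E p * indicator ?B p * ?k p) \<partial>lborel)"
    proof (intro nn_integral_mono)
      fix p :: "(real^'n) \<times> (real^'n)"
      show "(\<Sum>j. c j * (of_nat N' * (?q p * indicator E p * indicator ?B p * indicator (near (12 * ?s j)) p)))
        \<le> ennreal C * (?q p * indicator E p * indicator ?B p * ?k p)"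
      proof (cases "fst p = snd p")
        case False
        define t where "t = norm (fst p - snd p)"
        have t: "0 < t" using False by (simp add: t_def)
        define b where "b = ?q p * indicator E p * indicator ?B p"
        have "(\<Sum>j. c j * (of_nat N' * (b * indicator (near (12 * ?s j)) p)))
          = (\<Sum>j. (of_nat N' * b) * (c j * indicator {s. t \<le> 12 * s} (?s j)))"
          by (intro suminf_cong) (auto simp: near_def t_def dist_norm mult_ac split: split_indicator)
        also have "\<dots> = (of_nat N' * b) * (\<Sum>j. c j * indicator {s. t \<le> 12 * s} (?s j))"
          by (rule ennreal_suminf_cmult)
        also have "\<dots> \<le> (of_nat N' * b) * ennreal (2 * 12 powr a * t powr (- a))"
          unfolding c_def by (intro mult_left_mono suminf_dyadic_powr_le t R a) simp
        also have "\<dots> \<le> (of_nat N' * b) * ennreal (2 * 12 powr (real CARD('n) + 2) * t powr (- a))"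
          using a(2) by (intro mult_left_mono ennreal_leI mult_right_mono powr_mono) auto
        also have "\<dots> = ennreal C * (b * ennreal (t powr (- a)))"
          by (simp add: C_def ennreal_mult ennreal_of_nat_eq_real_of_nat mult_ac)
        also have "ennreal (t powr (- a)) = ?k p" using False by (simp add: frac_kernel_def t_def a_def)
        finally show ?thesis by (simp add: b_def)
      qed simp
    qed
    also have "\<dots> = ennreal C * (\<integral>\<^sup>+p. ?q p * indicator E p * indicator ?B p * ?k p \<partial>lborel)"
    proof (rule nn_integral_cmult)
      have "?k \<in> borel_measurable lborel" by (simp add: frac_kernel_measurable)
      moreover have "(\<lambda>p. ?q p * indicator E p * indicator ?B p) \<in> borel_measurable lborel"
        using qm[of "E \<inter> ?B"] Bm E by (simp add: indicator_inter_arith mult.assoc)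
      ultimately show "(\<lambda>p. ?q p * indicator E p * indicator ?B p * ?k p) \<in> borel_measurable lborel"
        by (rule borel_measurable_times_ennreal[rotated])
    qed
    finally show "(\<integral>\<^sup>+p. ?q p * indicator ?B p * ?k p \<partial>lborel)
      \<le> ennreal C * (\<integral>\<^sup>+p. ?q p * indicator E p * indicator ?B p * ?k p \<partial>lborel)" .
  qed
qed

section \<open>Double cones of an admissible configuration\<close>

text \<open>For positive \<open>t\<close>, squaring the hypothesis gives \<open>(norm h)\<^sup>2 +
  (cos \<theta> * t)\<^sup>2 < 2 * t * (v \<bullet> h)\<close>, and the left side is at least
  \<open>2 * norm h * (cos \<theta> * t)\<close>. Negative \<open>t\<close> is reduced to this by
  passing to \<open>- h\<close>.\<close>

lemma mem_double_cone_if_near_axis: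
  fixes v h :: "real^'n"
  assumes v: "norm v = 1" and \<theta>: "0 < \<theta>" "\<theta> \<le> \<phi>" "\<phi> \<le> pi / 2"
    and h: "norm (h - t *\<^sub>R v) < sin \<theta> * \<bar>t\<bar>"
  shows "h \<in> double_cone v \<phi>"
proof -
  have single: "g \<in> single_cone v \<phi>" if t: "0 < t" and g: "norm (g - t *\<^sub>R v) < sin \<theta> * t" for g t
  proof -
    have "sin \<theta> * t \<le> 1 * t" using t by (intro mult_right_mono) auto
    moreover have "norm (g - t *\<^sub>R v) = t" if "g = 0" using that t v by simp
    ultimately have "g \<noteq> 0" using g by linarith
    have "(norm (g - t *\<^sub>R v))\<^sup>2 < (sin \<theta> * t)\<^sup>2" using g by (intro power_strict_mono) auto
    also have "(sin \<theta> * t)\<^sup>2 = t\<^sup>2 - (cos \<theta> * t)\<^sup>2" by (simp add: power_mult_distrib sin_squared_eq algebra_simps)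
    finally have "(norm (g - t *\<^sub>R v))\<^sup>2 < t\<^sup>2 - (cos \<theta> * t)\<^sup>2" .
    moreover have "(norm (g - t *\<^sub>R v))\<^sup>2 = (norm g)\<^sup>2 - 2 * t * (v \<bullet> g) + t\<^sup>2"
    proof -
      have "v \<bullet> v = 1" using v by (simp add: norm_eq_1)
      thus ?thesis unfolding power2_norm_eq_inner
        by (simp add: inner_diff_left inner_diff_right inner_commute[of g v] power2_eq_square algebra_simps)
    qed
    ultimately have "(norm g)\<^sup>2 + (cos \<theta> * t)\<^sup>2 < 2 * t * (v \<bullet> g)" by linarith
    moreover have "2 * (norm g) * (cos \<theta> * t) \<le> (norm g)\<^sup>2 + (cos \<theta> * t)\<^sup>2" by (rule sum_squares_bound)
    ultimately have "t * (norm g * cos \<theta>) < t * (v \<bullet> g)" by (simp add: mult_ac)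
    hence "norm g * cos \<theta> < v \<bullet> g" using t by simp
    hence "cos \<theta> < v \<bullet> g / norm g" using \<open>g \<noteq> 0\<close> by (simp add: field_simps)
    moreover have "cos \<phi> \<le> cos \<theta>" using \<theta> by (intro cos_monotone_0_pi_le) auto
    ultimately show ?thesis using \<open>g \<noteq> 0\<close> by (simp add: single_cone_def)
  qed
  consider "0 < t" | "t = 0" | "t < 0" by linarith
  thus ?thesis
  proof cases
    case 1
    thus ?thesis using single[of t h] h by (simp add: double_cone_def)
  next
    case 2
    thus ?thesis using h by simp
  next
    case 3
    have "norm (- h - (- t) *\<^sub>R v) = norm (h - t *\<^sub>R v)" by (simp add: norm_minus_commute)
    hence "- h \<in> single_cone v \<phi>" using single[of "- t" "- h"] h 3 by simp
    hence "- (- h) \<in> uminus ` single_cone v \<phi>" by (rule imageI)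
    thus ?thesis by (simp add: double_cone_def)
  qed
qed

text \<open>Every apex angle is at least the infimum \<open>\<theta>\<close>, so
  \<open>sin \<theta>\<close> works at all points, whatever the axes.\<close>

lemma theta_bounded_contains_double_cones:
  fixes \<Gamma> :: "real^'n \<Rightarrow> (real^'n) set"
  assumes "theta_bounded \<theta> \<Gamma>"
  shows "contains_double_cones (sin \<theta>) {(x, y). y - x \<in> \<Gamma> x}"
  unfolding contains_double_cones_def
proof
  fix x
  obtain ang where ang: "\<And>V. V \<in> range \<Gamma> \<Longrightarrow> is_apex_angle V (ang V)"
    "\<theta> = (INF V\<in>range \<Gamma>. ang V)" "0 < \<theta>"
    using assms by (auto simp: theta_bounded_def)
  have "bdd_below (ang ` range \<Gamma>)" using ang(1) by (intro bdd_belowI[of _ 0]) (auto simp: is_apex_angle_def less_imp_le)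
  hence le: "\<theta> \<le> ang (\<Gamma> x)" unfolding ang(2) by (intro cINF_lower) auto
  obtain v where v: "norm v = 1" "\<Gamma> x = double_cone v (ang (\<Gamma> x))" "ang (\<Gamma> x) \<le> pi / 2"
    using ang(1)[of "\<Gamma> x"] by (auto simp: is_apex_angle_def)
  have "y - x \<in> \<Gamma> x" if "norm (y - x - t *\<^sub>R v) < sin \<theta> * \<bar>t\<bar>" for t y
    using that by (subst v(2), intro mem_double_cone_if_near_axis[OF v(1) ang(3) le v(3)])
  thus "\<exists>v. norm v = 1 \<and> (\<forall>t y. norm (y - x - t *\<^sub>R v) < sin \<theta> * \<bar>t\<bar> \<longrightarrow> (x, y) \<in> {(x, y). y - x \<in> \<Gamma> x})"
    using v(1) by auto
qed

section \<open>Passage to Borel functions and the given kernel\<close>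

text \<open>The strips \<open>N \<times> UNIV\<close> and \<open>UNIV \<times> N\<close> over a null
  set \<open>N\<close> are null in the product. Hence a function may be changed on a null set inside
  the double integrals.\<close>

lemma AE_lebesgue_pair:
  fixes P :: "'a::euclidean_space \<Rightarrow> bool"
  assumes "AE x in lborel. P x"
  shows "AE p in (lebesgue :: ('a \<times> 'a) measure). P (fst p) \<and> P (snd p)"
proof -
  obtain N where N: "N \<in> null_sets lborel" "{x. \<not> P x} \<subseteq> N"
    using assms by (auto elim!: AE_E simp: null_sets_def)
  have "N \<times> UNIV \<in> null_sets (lborel \<Otimes>\<^sub>M (lborel :: 'a measure))"
    "UNIV \<times> N \<in> null_sets ((lborel :: 'a measure) \<Otimes>\<^sub>M lborel)"
    using N(1) by (auto simp: null_sets_def lborel.emeasure_pair_measure_Times)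
  hence "N \<times> UNIV \<union> UNIV \<times> N \<in> null_sets (lborel :: ('a \<times> 'a) measure)"
    by (simp only: lborel_prod) auto
  hence "AE p in (lborel :: ('a \<times> 'a) measure). P (fst p) \<and> P (snd p)"
    by (rule AE_I') (use N(2) in auto)
  thus ?thesis by (rule AE_completion)
qed

theorem theorem1p1:
  fixes \<theta> \<Lambda> \<alpha>\<^sub>0 :: real
  assumes "0 < \<theta>" "\<theta> \<le> pi / 2" "1 \<le> \<Lambda>" "0 < \<alpha>\<^sub>0" "\<alpha>\<^sub>0 < 2"
  shows "\<exists>c::real. 1 \<le> c \<and>
    (\<forall>(\<alpha>::real) (\<Gamma> :: real^'n \<Rightarrow> (real^'n) set) (k :: (real^'n) \<times> (real^'n) \<Rightarrow> ennreal).
      \<alpha>\<^sub>0 \<le> \<alpha> \<longrightarrow> \<alpha> < 2 \<longrightarrow>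
      theta_admissible \<theta> \<Gamma> \<longrightarrow>
      k \<in> borel_measurable lebesgue \<longrightarrow>
      (\<forall>x y. k (x, y) = k (y, x)) \<longrightarrow>
      (\<forall>x y. ennreal (inverse \<Lambda>)
               * (indicator (shifted_cone \<Gamma> x) y + indicator (shifted_cone \<Gamma> y) x)
               * frac_kernel \<alpha> x y \<le> k (x, y)
           \<and> k (x, y) \<le> ennreal \<Lambda> * frac_kernel \<alpha> x y) \<longrightarrow>
      (\<forall>(z :: real^'n) (r::real) (f :: real^'n \<Rightarrow> real). 0 < r \<longrightarrow> L2_on (ball z r) f \<longrightarrow>
        (\<integral>\<^sup>+ (x, y) \<in> ball z r \<times> ball z r.
            (ennreal ((f x - f y)\<^sup>2) * frac_kernel \<alpha> x y) \<partial>lebesgue)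
        \<le> ennreal c * (\<integral>\<^sup>+ (x, y) \<in> ball z r \<times> ball z r.
            (ennreal ((f x - f y)\<^sup>2) * k (x, y)) \<partial>lebesgue)))"
proof -
  have sin: "0 < sin \<theta>" "sin \<theta> \<le> 1" using assms(1,2) by (auto intro!: sin_gt_zero)
  obtain C :: real where C: "0 \<le> C"
    "\<And>\<alpha> R (z::real^'n) (f :: real^'n \<Rightarrow> real) E. 0 < \<alpha> \<Longrightarrow> \<alpha> < 2 \<Longrightarrow> 0 < R \<Longrightarrow> f \<in> borel_measurable borel \<Longrightarrow>
      E \<in> sets borel \<Longrightarrow> contains_double_cones (sin \<theta>) E \<Longrightarrow>
      (\<integral>\<^sup>+p. ennreal ((f (fst p) - f (snd p))\<^sup>2) * indicator (ball z R \<times> ball z R) p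
          * frac_kernel \<alpha> (fst p) (snd p) \<partial>lborel)
      \<le> ennreal C * (\<integral>\<^sup>+p. ennreal ((f (fst p) - f (snd p))\<^sup>2) * indicator E p
          * indicator (ball z R \<times> ball z R) p * frac_kernel \<alpha> (fst p) (snd p) \<partial>lborel)"
    using kernel_poincare[OF sin] by blast
  \<comment> \<open>The factor \<open>\<Lambda>\<close> comes from the lower bound on
    \<open>k\<close>; the maximum secures a constant of at least 1.\<close>
  have main: "(\<integral>\<^sup>+ (x, y) \<in> ball z r \<times> ball z r. (ennreal ((f x - f y)\<^sup>2) * frac_kernel \<alpha> x y) \<partial>lebesgue)
      \<le> ennreal (max 1 (C * \<Lambda>)) * (\<integral>\<^sup>+ (x, y) \<in> ball z r \<times> ball z r. (ennreal ((f x - f y)\<^sup>2) * k (x, y)) \<partial>lebesgue)"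
    if \<alpha>: "0 < \<alpha>" "\<alpha> < 2" and \<Gamma>: "theta_admissible \<theta> \<Gamma>"
      and k: "\<And>x y. ennreal (inverse \<Lambda>) * (indicator (shifted_cone \<Gamma> x) y + indicator (shifted_cone \<Gamma> y) x)
               * frac_kernel \<alpha> x y \<le> k (x, y)"
      and km: "k \<in> borel_measurable lebesgue" and r: "0 < r" and f: "L2_on (ball z r) f"
    for \<alpha> r :: real and \<Gamma> :: "real^'n \<Rightarrow> (real^'n) set" and k :: "(real^'n) \<times> (real^'n) \<Rightarrow> ennreal" and z f
  proof -
    define E where "E = {(x, y). y - x \<in> \<Gamma> x}"
    have E: "E \<in> sets borel" "contains_double_cones (sin \<theta>) E"
      using \<Gamma> theta_bounded_contains_double_cones by (auto simp: theta_admissible_def E_def)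
    let ?B = "ball z r \<times> ball z r"
    \<comment> \<open>\<open>f\<close> is Lebesgue measurable on the ball only, whereas the
      estimates concern Borel functions on the space: extend by zero and take a Borel function that
      agrees almost everywhere.\<close>
    have "(\<lambda>x. if x \<in> ball z r then f x else 0) \<in> borel_measurable lebesgue"
      using f by (subst borel_measurable_if) (auto simp: L2_on_def)
    then obtain g where g: "g \<in> borel_measurable borel" "AE x in lborel. (if x \<in> ball z r then f x else 0) = g x"
      using completion_ex_borel_measurable_real[of _ lborel] by auto
    have AE: "AE p in lebesgue. p \<in> ?B \<longrightarrow> f (fst p) = g (fst p) \<and> f (snd p) = g (snd p)"
      using AE_lebesgue_pair[OF g(2)] by eventually_elim (auto split: if_splits)
    let ?q = "\<lambda>p. ennreal ((g (fst p) - g (snd p))\<^sup>2)"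
    let ?k = "\<lambda>p. frac_kernel \<alpha> (fst p) (snd p)"
    \<comment> \<open>On \<open>E\<close> the first indicator in the lower bound equals 1, so
      \<open>k\<close> dominates the kernel divided by \<open>\<Lambda>\<close>.\<close>
    have kE: "ennreal C * (indicator E p * ?k p) \<le> ennreal (max 1 (C * \<Lambda>)) * k p" for p
    proof (cases "p \<in> E")
      case True
      obtain x y where p: "p = (x, y)" by (cases p)
      have "y = x + (y - x)" by simp
      hence "y \<in> shifted_cone \<Gamma> x" using True p unfolding shifted_cone_def E_def by blast
      hence "ennreal (inverse \<Lambda>) * 1 * frac_kernel \<alpha> x y
          \<le> ennreal (inverse \<Lambda>) * (indicator (shifted_cone \<Gamma> x) y + indicator (shifted_cone \<Gamma> y) x) * frac_kernel \<alpha> x y"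
        by (intro mult_right_mono mult_left_mono) auto
      also have "\<dots> \<le> k p" using k p by simp
      finally have le: "ennreal (inverse \<Lambda>) * ?k p \<le> k p" using p by simp
      have "\<Lambda> \<noteq> 0" using assms(3) by simp
      hence "ennreal C = ennreal (C * \<Lambda>) * ennreal (inverse \<Lambda>)"
        using assms(3) C(1) by (subst ennreal_mult[symmetric]) auto
      hence "ennreal C * ?k p = ennreal (C * \<Lambda>) * (ennreal (inverse \<Lambda>) * ?k p)"
        by (simp only: mult.assoc)
      also have "\<dots> \<le> ennreal (max 1 (C * \<Lambda>)) * k p"
        by (intro mult_mono le ennreal_leI) auto
      finally show ?thesis using True by simp
    qed simp
    have "(\<integral>\<^sup>+ (x, y) \<in> ?B. (ennreal ((f x - f y)\<^sup>2) * frac_kernel \<alpha> x y) \<partial>lebesgue)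
      = (\<integral>\<^sup>+p. ?q p * indicator ?B p * ?k p \<partial>lebesgue)"
    proof (rule nn_integral_cong_AE)
      show "AE p in lebesgue. (case p of (x, y) \<Rightarrow> ennreal ((f x - f y)\<^sup>2) * frac_kernel \<alpha> x y) * indicator ?B p
        = ?q p * indicator ?B p * ?k p"
        using AE by eventually_elim (auto split: split_indicator)
    qed
    also have "\<dots> = (\<integral>\<^sup>+p. ?q p * indicator ?B p * ?k p \<partial>lborel)" by (rule nn_integral_completion)
    also have "\<dots> \<le> ennreal C * (\<integral>\<^sup>+p. ?q p * indicator E p * indicator ?B p * ?k p \<partial>lborel)"
      by (rule C(2)[OF \<alpha> r g(1) E])
    also have "\<dots> = ennreal C * (\<integral>\<^sup>+p. ?q p * indicator E p * indicator ?B p * ?k p \<partial>lebesgue)"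
      by (simp only: nn_integral_completion)
    also have "\<dots> \<le> ennreal (max 1 (C * \<Lambda>))
        * (\<integral>\<^sup>+ (x, y) \<in> ?B. (ennreal ((f x - f y)\<^sup>2) * k (x, y)) \<partial>lebesgue)"
    proof -
      have "(\<lambda>p. ?q p * indicator E p * indicator ?B p * ?k p) \<in> borel_measurable borel"
        using E(1) by (intro borel_measurable_times_ennreal frac_kernel_measurable gap_measurable g(1)
          borel_measurable_indicator) (auto intro: borel_open open_Times)
      hence m1: "(\<lambda>p. ?q p * indicator E p * indicator ?B p * ?k p) \<in> borel_measurable lebesgue"
        by (intro measurable_completion) simp
      have "(\<lambda>p. ?q p * indicator ?B p) \<in> borel_measurable borel"
        by (intro borel_measurable_times_ennreal gap_measurable g(1) borel_measurable_indicator)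
          (auto intro: borel_open open_Times)
      hence "(\<lambda>p. ?q p * indicator ?B p) \<in> borel_measurable lebesgue"
        by (intro measurable_completion) simp
      hence m2: "(\<lambda>p. ?q p * indicator ?B p * k p) \<in> borel_measurable lebesgue"
        using km by (rule borel_measurable_times_ennreal)
      have "ennreal C * (\<integral>\<^sup>+p. ?q p * indicator E p * indicator ?B p * ?k p \<partial>lebesgue)
        = (\<integral>\<^sup>+p. ennreal C * (?q p * indicator E p * indicator ?B p * ?k p) \<partial>lebesgue)"
        by (rule nn_integral_cmult[OF m1, symmetric])
      also have "\<dots> \<le> (\<integral>\<^sup>+p. ennreal (max 1 (C * \<Lambda>)) * (?q p * indicator ?B p * k p) \<partial>lebesgue)"
      proof (rule nn_integral_mono)
        fix p
        show "ennreal C * (?q p * indicator E p * indicator ?B p * ?k p)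
          \<le> ennreal (max 1 (C * \<Lambda>)) * (?q p * indicator ?B p * k p)"
          using mult_left_mono[OF kE[of p], of "?q p * indicator ?B p"] by (simp add: mult_ac)
      qed
      also have "\<dots> = ennreal (max 1 (C * \<Lambda>)) * (\<integral>\<^sup>+p. ?q p * indicator ?B p * k p \<partial>lebesgue)"
        by (rule nn_integral_cmult[OF m2])
      also have "(\<integral>\<^sup>+p. ?q p * indicator ?B p * k p \<partial>lebesgue)
        = (\<integral>\<^sup>+ (x, y) \<in> ?B. (ennreal ((f x - f y)\<^sup>2) * k (x, y)) \<partial>lebesgue)"
      proof (rule nn_integral_cong_AE)
        show "AE p in lebesgue. ?q p * indicator ?B p * k p
          = (case p of (x, y) \<Rightarrow> ennreal ((f x - f y)\<^sup>2) * k (x, y)) * indicator ?B p"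
          using AE by eventually_elim (auto split: split_indicator)
      qed
      finally show ?thesis .
    qed
    finally show ?thesis .
  qed
  show ?thesis
    by (rule exI[of _ "max 1 (C * \<Lambda>)"]) (use main assms(4) in auto)
qed

end
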